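(* Consider $U(2)$-invariant metrics $g=C\left(\frac{1}{4F}dz^2+F(\eta^1)^2+(\eta^2)^2+(\eta^3)^2\right)$, $F=F(z)>0$, $C=C(z)>0$. (a) The zero scalar curvature (ZSC) $B^t$-flat solutions, $t\ne\infty$, are precisely the ZSC Bach-flat solutions. (b) Assume $g$ is $B^t$-flat and conformally extremal, $t\ne0,\infty$. Then it has constant scalar curvature (CSC) if and only if it is ZSC or Einstein. (c) If $t\ne0,\infty$ there exist CSC $B^t$-flat solutions that are not conformally extremal.
   Context: Let $\eta^1,\eta^2,\eta^3$ be the left-invariant coframe on $\mathbb{S}^3$ with $d\eta^1=-2\eta^2\wedge\eta^3$ and cyclic permutations. The metric lives on $I\times\mathbb{S}^3$, $I$ an interval with coordinate $z$. For $t\in(-\infty,\infty]$, a metric is $B^t$-flat if it satisfies the Euler-Lagrange equations of $B^t(g)=\int|W|^2+t\int s^2$ (with $B^\infty=\int s^2$), where $W$ is the Weyl tensor and $s$ the scalar curvature. For finite $t$ these are $-4Bach+t\,\mathcal{C}=0$ with $\mathcal{C}=2\left(\nabla^2s-(\triangle s)g-s\mathring{\mathrm{Ric}}\right)$, where $Bach_{ij}=W_{sijt}{}^{,st}+\frac12W_{sijt}\mathrm{Ric}^{st}$ and $\mathring{\mathrm{Ric}}$ is the trace-free Ricci tensor. Bach-flat means $Bach=0$. A K\"ahler metric is extremal if it is critical for $\int s^2\,dVol$ under variations preserving the K\"ahler class (equivalently $J\nabla s$ is Killing); $g$ is conformally extremal if it is conformal to an extremal K\"ahler metric. In this $U(2)$-invariant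 setting this means $F=1+\frac12C_1e^{-2z}+C_2e^{-z}+C_3e^{z}+\frac12C_4e^{2z}$ for some real constants $C_i$ (then $g$ is conformal, with conformal factors $C=C_0e^{\mp z}$, to metrics extremal K\"ahler with respect to $J^\pm=\mp2F\frac{\partial}{\partial z}\otimes\eta^1\pm\frac1{2F}e_1\otimes dz-e_2\otimes\eta^3+e_3\otimes\eta^2$, $e_i$ being the frame dual to $\eta^i$).
   Formalization: In (b) the value t = −1/3 is also excluded: there F = 1+e^z+e^{-z}, C = e^{-z} gives a B^t-flat extremal Kähler metric with s = −24 that is neither ZSC nor Einstein. *)

theory Defs
  imports "HOL-Analysis.Analysis"
begin

text \<open>
  Riemannian geometry on I x S^3 in a left-invariant frame. S^3 is the unit sphere of C^2: (a, b)
  stands for the quaternion q = a + b j, and X_1, X_2, X_3 are the left-invariant vector fields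
  q i, q j, q k. They satisfy [X_1, X_2] = 2 X_3 and cyclic permutations, which for the dual
  coframe is d eta^1 = -2 eta^2 /\ eta^3 and cyclic permutations. The frame index 4 belongs to d/dz.
  All tensors are given by their components in the frame (e_1, e_2, e_3, e_4), which are functions
  on I x S^3. U(2) acts by the left multiplications of SU(2) and by the right multiplications by
  exp(i t), that is by the flow of X_1.
\<close>

type_synonym point = "real \<times> complex \<times> complex"
type_synonym metric = "point \<Rightarrow> real^4^4"
type_synonym tensor = "4 list \<Rightarrow> point \<Rightarrow> real"

definition cylinder :: "real set \<Rightarrow> point set" where
  "cylinder I = {(z, a, b). z \<in> I \<and> (cmod a)\<^sup>2 + (cmod b)\<^sup>2 = 1}"

text \<open>
  The derivative of a function along e_i. For i = 1, 2, 3 it is the derivative along the curves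
  q exp(t i), q exp(t j), q exp(t k), which stay on the sphere.
\<close>

definition frame :: "4 \<Rightarrow> (point \<Rightarrow> real) \<Rightarrow> point \<Rightarrow> real" where
  "frame i f = (\<lambda>(z, a, b).
     if i = 1 then deriv (\<lambda>t. f (z, a * cis t, b * cis (- t))) 0
     else if i = 2 then
       deriv (\<lambda>t. f (z, of_real (cos t) * a - of_real (sin t) * b,
                      of_real (sin t) * a + of_real (cos t) * b)) 0
     else if i = 3 then
       deriv (\<lambda>t. f (z, of_real (cos t) * a + \<i> * of_real (sin t) * b,
                      \<i> * of_real (sin t) * a + of_real (cos t) * b)) 0
     else deriv (\<lambda>t. f (t, a, b)) z)"

text \<open>The coefficient of e_k in [e_i, e_j].\<close>

definition struct_const :: "4 \<Rightarrow> 4 \<Rightarrow> 4 \<Rightarrow> real" where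
  "struct_const i j k =
     (if (i, j, k) \<in> {(1, 2, 3), (2, 3, 1), (3, 1, 2)} then 2
      else if (i, j, k) \<in> {(2, 1, 3), (3, 2, 1), (1, 3, 2)} then - 2
      else 0)"

text \<open>
  The frame has the structure constants above: the commutators agree on the coordinate functions
  of R x C^2.
\<close>

lemma frame_coordinates:
  "frame i (\<lambda>(z, a, b). c * z + x * Re a + y * Im a + v * Re b + w * Im b) =
   (\<lambda>(z, a, b).
     if i = 1 then y * Re a - x * Im a - w * Re b + v * Im b
     else if i = 2 then v * Re a + w * Im a - x * Re b - y * Im b
     else if i = 3 then w * Re a - v * Im a + y * Re b - x * Im b
     else c)"
proof (rule ext, clarify)
  fix z a b
  have 1: "deriv (\<lambda>t. c * t + k) z = c" for k :: real
    by (rule DERIV_imp_deriv) (auto intro!: derivative_eq_intros)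
  have 2: "deriv (\<lambda>t. k + (p * cos t + q * sin t)) 0 = q" for k p q :: real
    by (rule DERIV_imp_deriv) (auto intro!: derivative_eq_intros)
  have e1: "(\<lambda>t. c * z + x * Re (a * cis t) + y * Im (a * cis t)
        + v * Re (b * cis (- t)) + w * Im (b * cis (- t))) =
      (\<lambda>t. c * z + ((x * Re a + y * Im a + v * Re b + w * Im b) * cos t
        + (y * Re a - x * Im a - w * Re b + v * Im b) * sin t))"
    by (auto simp: fun_eq_iff algebra_simps)
  have e2: "(\<lambda>t. c * z + x * Re (of_real (cos t) * a - of_real (sin t) * b)
        + y * Im (of_real (cos t) * a - of_real (sin t) * b)
        + v * Re (of_real (sin t) * a + of_real (cos t) * b)
        + w * Im (of_real (sin t) * a + of_real (cos t) * b)) =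
      (\<lambda>t. c * z + ((x * Re a + y * Im a + v * Re b + w * Im b) * cos t
        + (v * Re a + w * Im a - x * Re b - y * Im b) * sin t))"
    by (auto simp: fun_eq_iff algebra_simps)
  have e3: "(\<lambda>t. c * z + x * Re (of_real (cos t) * a + \<i> * of_real (sin t) * b)
        + y * Im (of_real (cos t) * a + \<i> * of_real (sin t) * b)
        + v * Re (\<i> * of_real (sin t) * a + of_real (cos t) * b)
        + w * Im (\<i> * of_real (sin t) * a + of_real (cos t) * b)) =
      (\<lambda>t. c * z + ((x * Re a + y * Im a + v * Re b + w * Im b) * cos t
        + (w * Re a - v * Im a + y * Re b - x * Im b) * sin t))"
    by (auto simp: fun_eq_iff algebra_simps)
  have e4: "(\<lambda>t. c * t + x * Re a + y * Im a + v * Re b + w * Im b) =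
      (\<lambda>t. c * t + (x * Re a + y * Im a + v * Re b + w * Im b))"
    by (auto simp: fun_eq_iff)
  show "frame i (\<lambda>(z, a, b). c * z + x * Re a + y * Im a + v * Re b + w * Im b) (z, a, b) =
     (if i = 1 then y * Re a - x * Im a - w * Re b + v * Im b
     else if i = 2 then v * Re a + w * Im a - x * Re b - y * Im b
     else if i = 3 then w * Re a - v * Im a + y * Re b - x * Im b
     else c)"
    unfolding frame_def prod.case e1 e2 e3 e4 1 2 ..
qed

lemma frame_bracket:
  assumes "f = (\<lambda>(z, a, b). c * z + x * Re a + y * Im a + v * Re b + w * Im b)"
  shows "frame i (frame j f) p - frame j (frame i f) p =
    (\<Sum>k\<in>UNIV. struct_const i j k * frame k f p)"
proof -
  define L where "L c x y v w = (\<lambda>(z::real, a, b). c * z + x * Re a + y * Im a + v * Re b + w * Im b)"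
    for c x y v w :: real
  have F1: "frame 1 (L c x y v w) = L 0 y (- x) (- w) v" for c x y v w
    unfolding L_def frame_coordinates by (auto simp: fun_eq_iff)
  have F2: "frame 2 (L c x y v w) = L 0 v w (- x) (- y)" for c x y v w
    unfolding L_def frame_coordinates by (auto simp: fun_eq_iff)
  have F3: "frame 3 (L c x y v w) = L 0 w (- v) y (- x)" for c x y v w
    unfolding L_def frame_coordinates by (auto simp: fun_eq_iff)
  have F4: "frame 4 (L c x y v w) = (\<lambda>_. c)" for c x y v w
    unfolding L_def frame_coordinates by (auto simp: fun_eq_iff)
  have F0: "frame i (\<lambda>_. c) = (\<lambda>_. 0)" for i c
    by (auto simp: frame_def fun_eq_iff)
  have "f = L c x y v w" using assms by (simp add: L_def)
  then show ?thesis
    using exhaust_4[of i] exhaust_4[of j]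
    by (elim disjE; hypsubst; simp only: sum_4 F0 F1 F2 F3 F4)
       (simp_all add: struct_const_def L_def split: prod.splits)
qed

text \<open>The Koszul formula for g(nabla_{e_i} e_j, e_k).\<close>

definition koszul :: "metric \<Rightarrow> 4 \<Rightarrow> 4 \<Rightarrow> 4 \<Rightarrow> point \<Rightarrow> real" where
  "koszul g i j k p =
     (frame i (\<lambda>x. g x $ j $ k) p + frame j (\<lambda>x. g x $ i $ k) p - frame k (\<lambda>x. g x $ i $ j) p
      + (\<Sum>l\<in>UNIV. struct_const i j l * g p $ l $ k)
      - (\<Sum>l\<in>UNIV. struct_const i k l * g p $ l $ j)
      - (\<Sum>l\<in>UNIV. struct_const j k l * g p $ l $ i)) / 2"

abbreviation inv_metric :: "metric \<Rightarrow> 4 \<Rightarrow> 4 \<Rightarrow> point \<Rightarrow> real" where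
  "inv_metric g i j p \<equiv> matrix_inv (g p) $ i $ j"

text \<open>The coefficient of e_k in nabla_{e_i} e_j.\<close>

definition conn :: "metric \<Rightarrow> 4 \<Rightarrow> 4 \<Rightarrow> 4 \<Rightarrow> point \<Rightarrow> real" where
  "conn g i j k p = (\<Sum>l\<in>UNIV. koszul g i j l p * inv_metric g l k p)"

text \<open>Covariant derivative of a covariant tensor; the new index comes first.\<close>

fun cov_deriv :: "metric \<Rightarrow> tensor \<Rightarrow> tensor" where
  "cov_deriv g T [] p = 0"
| "cov_deriv g T (k # is) p =
     frame k (T is) p
     - (\<Sum>m<length is. \<Sum>l\<in>UNIV. conn g k (is ! m) l p * T (is[m := l]) p)"

text \<open>
  The coefficient of e_d in R(e_a, e_b) e_c, with R(X, Y) = [nabla_X, nabla_Y] - nabla_{[X, Y]}.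
  With all indices lowered R_abba is positive on the round sphere, so Ric_bc is the contraction of
  R_abcd over a and d.
\<close>

definition riemann_up :: "metric \<Rightarrow> 4 \<Rightarrow> 4 \<Rightarrow> 4 \<Rightarrow> 4 \<Rightarrow> point \<Rightarrow> real" where
  "riemann_up g a b c d p =
     frame a (conn g b c d) p - frame b (conn g a c d) p
     + (\<Sum>l\<in>UNIV. conn g b c l p * conn g a l d p - conn g a c l p * conn g b l d p
                    - struct_const a b l * conn g l c d p)"

definition riemann :: "metric \<Rightarrow> 4 \<Rightarrow> 4 \<Rightarrow> 4 \<Rightarrow> 4 \<Rightarrow> point \<Rightarrow> real" where
  "riemann g a b c d p = (\<Sum>l\<in>UNIV. riemann_up g a b c l p * g p $ l $ d)"

definition ricci :: "metric \<Rightarrow> 4 \<Rightarrow> 4 \<Rightarrow> point \<Rightarrow> real" where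
  "ricci g b c p = (\<Sum>a\<in>UNIV. \<Sum>d\<in>UNIV. inv_metric g a d p * riemann g a b c d p)"

definition scal :: "metric \<Rightarrow> point \<Rightarrow> real" where
  "scal g p = (\<Sum>b\<in>UNIV. \<Sum>c\<in>UNIV. inv_metric g b c p * ricci g b c p)"

definition ricci0 :: "metric \<Rightarrow> 4 \<Rightarrow> 4 \<Rightarrow> point \<Rightarrow> real" where
  "ricci0 g i j p = ricci g i j p - scal g p / 4 * g p $ i $ j"

definition weyl :: "metric \<Rightarrow> 4 \<Rightarrow> 4 \<Rightarrow> 4 \<Rightarrow> 4 \<Rightarrow> point \<Rightarrow> real" where
  "weyl g a b c d p =
     riemann g a b c d p
     - (g p $ a $ d * ricci g b c p + g p $ b $ c * ricci g a d p
        - g p $ a $ c * ricci g b d p - g p $ b $ d * ricci g a c p) / 2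
     + scal g p / 6 * (g p $ a $ d * g p $ b $ c - g p $ a $ c * g p $ b $ d)"

definition weyl_tensor :: "metric \<Rightarrow> tensor" where
  "weyl_tensor g is = weyl g (is ! 0) (is ! 1) (is ! 2) (is ! 3)"

text \<open>The Hessian and the Laplacian (its trace) of a function.\<close>

definition hess :: "metric \<Rightarrow> (point \<Rightarrow> real) \<Rightarrow> 4 \<Rightarrow> 4 \<Rightarrow> point \<Rightarrow> real" where
  "hess g f i j = cov_deriv g (cov_deriv g (\<lambda>_. f)) [i, j]"

definition laplace :: "metric \<Rightarrow> (point \<Rightarrow> real) \<Rightarrow> point \<Rightarrow> real" where
  "laplace g f p = (\<Sum>i\<in>UNIV. \<Sum>j\<in>UNIV. inv_metric g i j p * hess g f i j p)"

text \<open>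
  Bach_ij = W_sijt^{,st} + 1/2 W_sijt Ric^st; the index list [l, k, s, i, j, t] of the second
  covariant derivative stands for W_{sijt,kl}.
\<close>

definition bach :: "metric \<Rightarrow> 4 \<Rightarrow> 4 \<Rightarrow> point \<Rightarrow> real" where
  "bach g i j p =
     (\<Sum>s\<in>UNIV. \<Sum>t\<in>UNIV. \<Sum>k\<in>UNIV. \<Sum>l\<in>UNIV. inv_metric g s k p * inv_metric g t l p *
        (cov_deriv g (cov_deriv g (weyl_tensor g)) [l, k, s, i, j, t] p
         + 1/2 * weyl g s i j t p * ricci g k l p))"

text \<open>The Euler-Lagrange tensor of the integral of the squared scalar curvature.\<close>

definition scal_sq_gradient :: "metric \<Rightarrow> 4 \<Rightarrow> 4 \<Rightarrow> point \<Rightarrow> real" where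
  "scal_sq_gradient g i j p =
     2 * (hess g (scal g) i j p - laplace g (scal g) p * g p $ i $ j - scal g p * ricci0 g i j p)"

definition Bt_flat :: "real \<Rightarrow> point set \<Rightarrow> metric \<Rightarrow> bool" where
  "Bt_flat t M g \<longleftrightarrow> (\<forall>p\<in>M. \<forall>i j. - 4 * bach g i j p + t * scal_sq_gradient g i j p = 0)"

definition Bach_flat :: "point set \<Rightarrow> metric \<Rightarrow> bool" where
  "Bach_flat M g \<longleftrightarrow> (\<forall>p\<in>M. \<forall>i j. bach g i j p = 0)"

definition CSC :: "point set \<Rightarrow> metric \<Rightarrow> bool" where
  "CSC M g \<longleftrightarrow> (\<exists>k. \<forall>p\<in>M. scal g p = k)"

definition ZSC :: "point set \<Rightarrow> metric \<Rightarrow> bool" where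
  "ZSC M g \<longleftrightarrow> (\<forall>p\<in>M. scal g p = 0)"

definition Einstein :: "point set \<Rightarrow> metric \<Rightarrow> bool" where
  "Einstein M g \<longleftrightarrow> (\<exists>k. \<forall>p\<in>M. \<forall>i j. ricci g i j p = k * g p $ i $ j)"

text \<open>
  Fields of endomorphisms are matrices acting on component vectors:
  J e_b is the sum over a of J $ a $ b times e_a.
\<close>

definition cov_deriv_endo :: "metric \<Rightarrow> (point \<Rightarrow> real^4^4) \<Rightarrow> 4 \<Rightarrow> 4 \<Rightarrow> 4 \<Rightarrow> point \<Rightarrow> real" where
  "cov_deriv_endo g J k a b p =
     frame k (\<lambda>x. J x $ a $ b) p
     + (\<Sum>l\<in>UNIV. conn g k l a p * J p $ l $ b - conn g k b l p * J p $ a $ l)"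

definition Kahler :: "point set \<Rightarrow> metric \<Rightarrow> (point \<Rightarrow> real^4^4) \<Rightarrow> bool" where
  "Kahler M g J \<longleftrightarrow>
     (\<forall>p\<in>M. J p ** J p = - mat 1 \<and> transpose (J p) ** g p ** J p = g p \<and>
            (\<forall>k a b. cov_deriv_endo g J k a b p = 0))"

definition grad :: "metric \<Rightarrow> (point \<Rightarrow> real) \<Rightarrow> point \<Rightarrow> real^4" where
  "grad g f p = (\<chi> a. \<Sum>b\<in>UNIV. inv_metric g a b p * frame b f p)"

definition lower :: "metric \<Rightarrow> (point \<Rightarrow> real^4) \<Rightarrow> tensor" where
  "lower g X is p = (g p *v X p) $ (is ! 0)"

definition Killing :: "point set \<Rightarrow> metric \<Rightarrow> (point \<Rightarrow> real^4) \<Rightarrow> bool" where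
  "Killing M g X \<longleftrightarrow>
     (\<forall>p\<in>M. \<forall>i j. cov_deriv g (lower g X) [i, j] p + cov_deriv g (lower g X) [j, i] p = 0)"

definition extremal_Kahler :: "point set \<Rightarrow> metric \<Rightarrow> (point \<Rightarrow> real^4^4) \<Rightarrow> bool" where
  "extremal_Kahler M g J \<longleftrightarrow> Kahler M g J \<and> Killing M g (\<lambda>p. J p *v grad g (scal g) p)"

definition smooth :: "real set \<Rightarrow> (real \<Rightarrow> real) \<Rightarrow> bool" where
  "smooth I f \<longleftrightarrow> (\<forall>n. \<forall>x\<in>I. (deriv ^^ n) f differentiable at x)"

text \<open>
  The frame is invariant under SU(2), so an endomorphism field is SU(2)-invariant iff its
  components depend on z only; it is then U(2)-invariant iff its Lie derivative along e_1
  vanishes, that is iff it commutes with ad e_1.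
\<close>

definition U2_invariant_endo :: "real set \<Rightarrow> (real \<Rightarrow> real^4^4) \<Rightarrow> bool" where
  "U2_invariant_endo I J \<longleftrightarrow>
     (\<forall>a b. smooth I (\<lambda>z. J z $ a $ b)) \<and>
     (\<forall>z\<in>I. let ad = (\<chi> a b. struct_const 1 b a) in ad ** J z = J z ** ad)"

text \<open>
  Conformal to an extremal Kahler metric, in the U(2)-invariant setting: the conformal factor and
  the complex structure are U(2)-invariant.
\<close>

definition conformally_extremal :: "real set \<Rightarrow> metric \<Rightarrow> bool" where
  "conformally_extremal I g \<longleftrightarrow>
     (\<exists>u J. smooth I u \<and> (\<forall>z\<in>I. u z > 0) \<and> U2_invariant_endo I J \<and>
            extremal_Kahler (cylinder I) (\<lambda>p. u (fst p) *\<^sub>R g p) (\<lambda>p. J (fst p)))"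

text \<open>The metric C (dz^2 / (4 F) + F (eta^1)^2 + (eta^2)^2 + (eta^3)^2).\<close>

definition U2_metric :: "(real \<Rightarrow> real) \<Rightarrow> (real \<Rightarrow> real) \<Rightarrow> metric" where
  "U2_metric F C = (\<lambda>(z, q). C z *\<^sub>R (\<chi> i j. if i \<noteq> j then 0 else if i = 4 then 1 / (4 * F z)
                                        else if i = 1 then F z else 1))"

definition U2_data :: "real set \<Rightarrow> (real \<Rightarrow> real) \<Rightarrow> (real \<Rightarrow> real) \<Rightarrow> bool" where
  "U2_data I F C \<longleftrightarrow>
     is_interval I \<and> open I \<and> I \<noteq> {} \<and> smooth I F \<and> smooth I C \<and> (\<forall>z\<in>I. F z > 0 \<and> C z > 0)"

end

theory Submission
  imports Defs
begin

text \<open>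
In the frame $(e_1, \dots, e_4)$ everything is a function of $z$, so all three parts are statements
about $F$, $C$ and the logarithmic derivative $c = C'/(2C)$. Write
\<open>Q = F'''' - 5 F'' + 4 F - 4\<close>, \<open>E = F''\<^sup>2 - 2 F' F''' + 5 F'\<^sup>2 - 4 (F - 1)\<^sup>2\<close> and
\<open>P = c\<^sup>2 - c' - 1/4\<close>. The Bach tensor is conformally covariant, and on this family
$\int |W|^2$ is a multiple of $\int (F'' + 2(F-1))^2 + 9 F'^2$. Its Euler-Lagrange equation is
\<open>Q = 0\<close>, its Hamiltonian is \<open>E\<close>, and the Bach tensor is diagonal with entries combined from
\<open>E\<close> and \<open>F Q\<close> (lemma \<open>bach_eq\<close>). If the scalar curvature is a constant \<open>k\<close>, then the gradient
of $\int s^2$ is \<open>- 2 k\<close> times the trace-free Ricci tensor, and $B^t$-flatness becomes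
two scalar equations (lemma \<open>Bt_flat_CSC_iff\<close>), one for \<open>Q\<close> and one for \<open>E\<close>.

(a) When the scalar curvature vanishes, the gradient of $\int s^2$ vanishes identically.

(b) An invariant complex structure for which some conformal multiple of the metric is extremal Kahler
forces \<open>Q = 0\<close>: the Kahler condition makes the factor $K$ of that multiple satisfy \<open>(K'/(2K))\<^sup>2 = 1/4\<close>,
and $J \nabla s$ is Killing only if \<open>s'/K\<close> is constant, which is the fourth order equation
\<open>Q = 0\<close> (lemma \<open>conformally_extremal_imp_extremal_op_zero\<close>). Then \<open>P = 0\<close> if \<open>k t\<close> is nonzero,
and the trace-free Ricci tensor has a single component \<open>m\<close>, constant up to the conformal weight.
Computing \<open>E\<close> from the curvature gives \<open>E = m (k/4 - 3 n F)\<close> with a constant \<open>n\<close>, whereas the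
$B^t$ equation says \<open>E = - 3/4 t k m\<close>. Unless \<open>t = - 1/3\<close> these agree only for \<open>m = 0\<close>, that is for
Einstein metrics (lemma \<open>CSC_Bt_flat_imp_tracefree_Ricci_zero\<close>).

(c) Constancy of \<open>s = k\<close> can be solved for \<open>c'\<close>, and the equation for \<open>Q\<close> can be solved for \<open>F''''\<close>.
This is an ordinary differential equation for \<open>(F, F', F'', F''', c, C)\<close>, and the remaining equation,
the one for \<open>E\<close>, is a first integral of it. Initial values with \<open>P = 1\<close> on the zero level of this
integral give a local solution with \<open>Q\<close> nonzero, hence one that is not conformally extremal.
\<close>

section \<open>Derivatives along the frame\<close>

text \<open>
Components that depend on $z$ only need to be known on $I$: the derivatives along $e_1, e_2, e_3$
are taken at fixed $z$, and the derivative along $e_4$ is local.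
\<close>

lemma frame_at:
  assumes eq: "\<And>x q. x \<in> I \<Longrightarrow> f (x, q) = h x"
    and I: "open I" "z \<in> I" and h: "(h has_real_derivative h') (at z)"
  shows "frame i f (z, q) = (if i = 4 then h' else 0)"
proof -
  obtain a b where q: "q = (a, b)" by force
  have "deriv (\<lambda>t. f (t, a, b)) z = h'"
  proof (rule DERIV_imp_deriv)
    have "eventually (\<lambda>t. f (t, a, b) = h t) (nhds z)"
      using eventually_nhds_in_open[OF I] by eventually_elim (simp add: eq)
    then show "((\<lambda>t. f (t, a, b)) has_real_derivative h') (at z)"
      using h by (simp add: DERIV_cong_ev)
  qed
  then show ?thesis
    using exhaust_4[of i] I by (auto simp: q frame_def eq)
qed

text \<open>
Near a point of the cylinder the integral curves of the frame stay in it, so constancy on the cylinder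
is enough, whatever the values outside the sphere are.
\<close>

lemma frame_const:
  assumes I: "open I" and f: "\<And>p. p \<in> cylinder I \<Longrightarrow> f p = k" and p: "p \<in> cylinder I"
  shows "frame i f p = 0"
proof -
  obtain z a b where q: "p = (z, a, b)" "z \<in> I" "(cmod a)\<^sup>2 + (cmod b)\<^sup>2 = 1"
    using p by (auto simp: cylinder_def)
  have 1: "(z, a * cis t, b * cis (- t)) \<in> cylinder I" for t
    using q by (simp add: cylinder_def norm_mult)
  have trig: "(cos t * u - sin t * v)\<^sup>2 + (sin t * u + cos t * v)\<^sup>2 = u\<^sup>2 + v\<^sup>2" for t u v :: real
    using sin_cos_squared_add[of t] by algebra
  have 2: "(z, of_real (cos t) * a - of_real (sin t) * b, of_real (sin t) * a + of_real (cos t) * b)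
      \<in> cylinder I" for t
    using q(2,3) trig[of t "Re a" "Re b"] trig[of t "Im a" "Im b"]
    by (simp add: cylinder_def cmod_power2)
  have 3: "(z, of_real (cos t) * a + \<i> * of_real (sin t) * b,
      \<i> * of_real (sin t) * a + of_real (cos t) * b) \<in> cylinder I" for t
    using q(2,3) trig[of t "Re a" "Im b"] trig[of "- t" "Im a" "Re b"]
    by (simp add: cylinder_def cmod_power2 algebra_simps)
  have "deriv (\<lambda>t. f (t, a, b)) z = 0"
  proof (rule DERIV_imp_deriv)
    have "eventually (\<lambda>t. f (t, a, b) = k) (nhds z)"
      using eventually_nhds_in_open[OF I q(2)]
      by eventually_elim (use q(3) in \<open>auto intro!: f simp: cylinder_def\<close>)
    then show "((\<lambda>t. f (t, a, b)) has_real_derivative 0) (at z)"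
      by (simp add: DERIV_cong_ev)
  qed
  then show ?thesis
    by (simp add: q(1) frame_def f[OF 1] f[OF 2] f[OF 3])
qed

lemma hess_const:
  assumes I: "open I" and f: "\<And>p. p \<in> cylinder I \<Longrightarrow> f p = k" and p: "p \<in> cylinder I"
  shows "hess G f i j p = 0"
proof -
  have d: "cov_deriv G (\<lambda>_. f) [l] x = 0" if "x \<in> cylinder I" for x l
    using frame_const[OF I f that] by simp
  have "frame i (cov_deriv G (\<lambda>_. f) [j]) p = 0"
    by (rule frame_const[OF I d p])
  then show ?thesis
    using d[OF p] by (simp add: hess_def)
qed

text \<open>
For constant scalar curvature only the algebraic term of the Euler-Lagrange tensor survives.
\<close>

lemma scal_sq_gradient_CSC:
  assumes I: "open I" and f: "\<And>p. p \<in> cylinder I \<Longrightarrow> scal G p = k" and p: "p \<in> cylinder I"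
  shows "scal_sq_gradient G i j p = - 2 * k * ricci0 G i j p"
  using hess_const[OF I f p] f[OF p] by (simp add: scal_sq_gradient_def laplace_def)

lemma ZSC_Bt_flat_iff_Bach_flat:
  assumes "open I" and "ZSC (cylinder I) G"
  shows "Bt_flat t (cylinder I) G \<longleftrightarrow> Bach_flat (cylinder I) G"
  using scal_sq_gradient_CSC[OF assms(1), of G 0] assms(2)
  by (simp add: ZSC_def Bt_flat_def Bach_flat_def)

section \<open>Connection and curvature\<close>

text \<open>
The conformal factor enters through \<open>c\<close>, the logarithmic derivative of \<open>sqrt C\<close>: the connection is
affine in it. The functions \<open>F1\<close> to \<open>F4\<close> and \<open>c1\<close> are the derivatives of \<open>F\<close> and \<open>c\<close>. They are
parameters because they come as iterated derivatives in one application and as components of the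
solution of a differential equation in the other.
\<close>

locale U2_geometry =
  fixes I :: "real set" and F F1 F2 F3 F4 C c c1 :: "real \<Rightarrow> real"
  assumes open_I: "open I"
    and F_pos: "z \<in> I \<Longrightarrow> F z > 0" and C_pos: "z \<in> I \<Longrightarrow> C z > 0"
    and dF: "z \<in> I \<Longrightarrow> (F has_real_derivative F1 z) (at z)"
    and dF1: "z \<in> I \<Longrightarrow> (F1 has_real_derivative F2 z) (at z)"
    and dF2: "z \<in> I \<Longrightarrow> (F2 has_real_derivative F3 z) (at z)"
    and dF3: "z \<in> I \<Longrightarrow> (F3 has_real_derivative F4 z) (at z)"
    and dC: "z \<in> I \<Longrightarrow> (C has_real_derivative 2 * c z * C z) (at z)"
    and dc: "z \<in> I \<Longrightarrow> (c has_real_derivative c1 z) (at z)"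
begin

lemmas has_derivs = dF[THEN DERIV_cong] dF1[THEN DERIV_cong] dF2[THEN DERIV_cong]
  dF3[THEN DERIV_cong] dC[THEN DERIV_cong] dc[THEN DERIV_cong]

abbreviation g where "g \<equiv> U2_metric F C"

definition gdiag :: "4 \<Rightarrow> real \<Rightarrow> real" where
  "gdiag i z = (if i = 1 then C z * F z else if i = 4 then C z / (4 * F z) else C z)"

lemma gdiag_table: "gdiag 1 z = C z * F z" "gdiag 2 z = C z" "gdiag 3 z = C z" "gdiag 4 z = C z / (4 * F z)"
  by (simp_all add: gdiag_def)

lemma gdiag_pos: "z \<in> I \<Longrightarrow> gdiag i z > 0"
  using F_pos C_pos by (simp add: gdiag_def)

lemma metric_entry: "g (z, q) $ i $ j = (if i = j then gdiag i z else 0)"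
  by (auto simp: U2_metric_def gdiag_def)

lemma inverse_entry:
  assumes "z \<in> I" shows "inv_metric g i j (z, q) = (if i = j then 1 / gdiag i z else 0)"
proof -
  define B :: "real^4^4" where "B = (\<chi> i j. if i = j then 1 / gdiag i z else 0)"
  have 1: "g (z, q) ** B = mat 1"
    using gdiag_pos[OF assms] unfolding matrix_matrix_mult_def vec_eq_iff
    by (auto simp: metric_entry B_def mat_def if_distrib[of "\<lambda>x. x * _"] less_imp_neq[symmetric] cong: if_cong)
  have 2: "B ** g (z, q) = mat 1"
    using 1 by (simp add: matrix_left_right_inverse)
  have "matrix_inv (g (z, q)) = B"
    unfolding matrix_inv_def
  proof (rule some_equality)
    fix A assume "g (z, q) ** A = mat 1 \<and> A ** g (z, q) = mat 1"
    then have "A = A ** (g (z, q) ** B)" using 1 by simp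
    also have "\<dots> = B" using \<open>g (z, q) ** A = mat 1 \<and> A ** g (z, q) = mat 1\<close>
      by (simp add: matrix_mul_assoc)
    finally show "A = B" .
  qed (use 1 2 in simp)
  then show ?thesis by (simp add: B_def)
qed

definition gdiag' :: "4 \<Rightarrow> real \<Rightarrow> real" where
  "gdiag' i z = (if i = 1 then C z * (2 * c z * F z + F1 z)
    else if i = 4 then C z * (2 * c z * F z - F1 z) / (4 * (F z)\<^sup>2) else 2 * c z * C z)"

lemma gdiag'_table: "gdiag' 1 z = C z * (2 * c z * F z + F1 z)" "gdiag' 2 z = 2 * c z * C z"
  "gdiag' 3 z = 2 * c z * C z" "gdiag' 4 z = C z * (2 * c z * F z - F1 z) / (4 * (F z)\<^sup>2)"
  by (simp_all add: gdiag'_def)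

lemma gdiag_deriv: "z \<in> I \<Longrightarrow> (gdiag i has_real_derivative gdiag' i z) (at z)"
  using F_pos[of z] unfolding gdiag_def[abs_def] gdiag'_def
  by (auto intro!: derivative_eq_intros has_derivs simp: field_simps power2_eq_square)

text \<open>
The coefficient of $e_k$ in the covariant derivative of $e_j$ along $e_i$, as given by the Koszul formula.
The entries with a 4 among the indices come from the dependence on $z$, the others from the brackets.
\<close>

definition chris :: "4 \<Rightarrow> 4 \<Rightarrow> 4 \<Rightarrow> real \<Rightarrow> real" where
  "chris i j k z =
    (if (i, j, k) = (4, 4, 4) then c z - F1 z / (2 * F z)
     else if (i, j, k) \<in> {(1, 4, 1), (4, 1, 1)} then c z + F1 z / (2 * F z)
     else if (i, j, k) \<in> {(2, 4, 2), (4, 2, 2), (3, 4, 3), (4, 3, 3)} then c z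
     else if (i, j, k) = (1, 1, 4) then - 2 * F z * (2 * c z * F z + F1 z)
     else if (i, j, k) \<in> {(2, 2, 4), (3, 3, 4)} then - 4 * F z * c z
     else if (i, j, k) = (1, 2, 3) then 2 - F z
     else if (i, j, k) = (1, 3, 2) then F z - 2
     else if (i, j, k) = (2, 1, 3) then - F z
     else if (i, j, k) = (3, 1, 2) then F z
     else if (i, j, k) = (2, 3, 1) then 1
     else if (i, j, k) = (3, 2, 1) then - 1
     else 0)"

text \<open>
Here and for the Christoffel symbols the values at all index triples are stated as rewrite rules. The
curvature computations sum over indices, and unfolding the case distinctions there in each summand
would dominate their cost.
\<close>

lemma struct_const_table:
  "struct_const 1 1 1 = 0" "struct_const 1 1 2 = 0" "struct_const 1 1 3 = 0"
  "struct_const 1 1 4 = 0" "struct_const 1 2 1 = 0" "struct_const 1 2 2 = 0"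
  "struct_const 1 2 3 = 2" "struct_const 1 2 4 = 0" "struct_const 1 3 1 = 0"
  "struct_const 1 3 2 = - 2" "struct_const 1 3 3 = 0" "struct_const 1 3 4 = 0"
  "struct_const 1 4 1 = 0" "struct_const 1 4 2 = 0" "struct_const 1 4 3 = 0"
  "struct_const 1 4 4 = 0" "struct_const 2 1 1 = 0" "struct_const 2 1 2 = 0"
  "struct_const 2 1 3 = - 2" "struct_const 2 1 4 = 0" "struct_const 2 2 1 = 0"
  "struct_const 2 2 2 = 0" "struct_const 2 2 3 = 0" "struct_const 2 2 4 = 0"
  "struct_const 2 3 1 = 2" "struct_const 2 3 2 = 0" "struct_const 2 3 3 = 0"
  "struct_const 2 3 4 = 0" "struct_const 2 4 1 = 0" "struct_const 2 4 2 = 0"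
  "struct_const 2 4 3 = 0" "struct_const 2 4 4 = 0" "struct_const 3 1 1 = 0"
  "struct_const 3 1 2 = 2" "struct_const 3 1 3 = 0" "struct_const 3 1 4 = 0"
  "struct_const 3 2 1 = - 2" "struct_const 3 2 2 = 0" "struct_const 3 2 3 = 0"
  "struct_const 3 2 4 = 0" "struct_const 3 3 1 = 0" "struct_const 3 3 2 = 0"
  "struct_const 3 3 3 = 0" "struct_const 3 3 4 = 0" "struct_const 3 4 1 = 0"
  "struct_const 3 4 2 = 0" "struct_const 3 4 3 = 0" "struct_const 3 4 4 = 0"
  "struct_const 4 1 1 = 0" "struct_const 4 1 2 = 0" "struct_const 4 1 3 = 0"
  "struct_const 4 1 4 = 0" "struct_const 4 2 1 = 0" "struct_const 4 2 2 = 0"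
  "struct_const 4 2 3 = 0" "struct_const 4 2 4 = 0" "struct_const 4 3 1 = 0"
  "struct_const 4 3 2 = 0" "struct_const 4 3 3 = 0" "struct_const 4 3 4 = 0"
  "struct_const 4 4 1 = 0" "struct_const 4 4 2 = 0" "struct_const 4 4 3 = 0"
  "struct_const 4 4 4 = 0"
  by (simp_all add: struct_const_def)

lemma chris_table:
  "chris 1 1 1 z = 0" "chris 1 1 2 z = 0" "chris 1 1 3 z = 0"
  "chris 1 1 4 z = - 2 * F z * (2 * c z * F z + F1 z)" "chris 1 2 1 z = 0" "chris 1 2 2 z = 0"
  "chris 1 2 3 z = 2 - F z" "chris 1 2 4 z = 0" "chris 1 3 1 z = 0" "chris 1 3 2 z = F z - 2"
  "chris 1 3 3 z = 0" "chris 1 3 4 z = 0" "chris 1 4 1 z = c z + F1 z / (2 * F z)" "chris 1 4 2 z = 0"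
  "chris 1 4 3 z = 0" "chris 1 4 4 z = 0" "chris 2 1 1 z = 0" "chris 2 1 2 z = 0" "chris 2 1 3 z = - F z"
  "chris 2 1 4 z = 0" "chris 2 2 1 z = 0" "chris 2 2 2 z = 0" "chris 2 2 3 z = 0"
  "chris 2 2 4 z = - 4 * F z * c z" "chris 2 3 1 z = 1" "chris 2 3 2 z = 0" "chris 2 3 3 z = 0"
  "chris 2 3 4 z = 0" "chris 2 4 1 z = 0" "chris 2 4 2 z = c z" "chris 2 4 3 z = 0" "chris 2 4 4 z = 0"
  "chris 3 1 1 z = 0" "chris 3 1 2 z = F z" "chris 3 1 3 z = 0" "chris 3 1 4 z = 0" "chris 3 2 1 z = - 1"
  "chris 3 2 2 z = 0" "chris 3 2 3 z = 0" "chris 3 2 4 z = 0" "chris 3 3 1 z = 0" "chris 3 3 2 z = 0"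
  "chris 3 3 3 z = 0" "chris 3 3 4 z = - 4 * F z * c z" "chris 3 4 1 z = 0" "chris 3 4 2 z = 0"
  "chris 3 4 3 z = c z" "chris 3 4 4 z = 0" "chris 4 1 1 z = c z + F1 z / (2 * F z)" "chris 4 1 2 z = 0"
  "chris 4 1 3 z = 0" "chris 4 1 4 z = 0" "chris 4 2 1 z = 0" "chris 4 2 2 z = c z" "chris 4 2 3 z = 0"
  "chris 4 2 4 z = 0" "chris 4 3 1 z = 0" "chris 4 3 2 z = 0" "chris 4 3 3 z = c z" "chris 4 3 4 z = 0"
  "chris 4 4 1 z = 0" "chris 4 4 2 z = 0" "chris 4 4 3 z = 0" "chris 4 4 4 z = c z - F1 z / (2 * F z)"
  by (simp_all add: chris_def)

lemma conn_eq:
  assumes z: "z \<in> I" shows "conn g i j k (z, q) = chris i j k z"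
proof -
  have fr: "frame i (\<lambda>x. g x $ j $ k) (z, q) = (if i = 4 then (if j = k then gdiag' j z else 0) else 0)"
    for i j k
    by (rule frame_at[where I = I and h = "\<lambda>x. if j = k then gdiag j x else 0"])
       (use open_I z gdiag_deriv[OF z] in \<open>auto simp: metric_entry\<close>)
  have "conn g i j k (z, q) = koszul g i j k (z, q) / gdiag k z"
    by (simp add: conn_def inverse_entry[OF z] if_distrib[of "\<lambda>x. _ * x"] cong: if_cong)
  also have "\<dots> = chris i j k z"
    unfolding koszul_def fr metric_entry sum_4
    using exhaust_4[of i] exhaust_4[of j] exhaust_4[of k] F_pos[OF z] C_pos[OF z]
    by (elim disjE; hypsubst)
      (simp_all add: struct_const_table chris_table gdiag'_table gdiag_table field_simps power2_eq_square)
  finally show ?thesis .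
qed

definition chris' :: "4 \<Rightarrow> 4 \<Rightarrow> 4 \<Rightarrow> real \<Rightarrow> real" where
  "chris' i j k z =
    (if (i, j, k) = (4, 4, 4) then c1 z - (F2 z * F z - (F1 z)\<^sup>2) / (2 * (F z)\<^sup>2)
     else if (i, j, k) \<in> {(1, 4, 1), (4, 1, 1)} then c1 z + (F2 z * F z - (F1 z)\<^sup>2) / (2 * (F z)\<^sup>2)
     else if (i, j, k) \<in> {(2, 4, 2), (4, 2, 2), (3, 4, 3), (4, 3, 3)} then c1 z
     else if (i, j, k) = (1, 1, 4) then - 2 * F1 z * (2 * c z * F z + F1 z)
        - 2 * F z * (2 * c1 z * F z + 2 * c z * F1 z + F2 z)
     else if (i, j, k) \<in> {(2, 2, 4), (3, 3, 4)} then - 4 * F1 z * c z - 4 * F z * c1 z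
     else if (i, j, k) = (1, 2, 3) then - F1 z
     else if (i, j, k) = (1, 3, 2) then F1 z
     else if (i, j, k) = (2, 1, 3) then - F1 z
     else if (i, j, k) = (3, 1, 2) then F1 z
     else 0)"

lemma chris'_table:
  "chris' 1 1 1 z = 0" "chris' 1 1 2 z = 0" "chris' 1 1 3 z = 0"
  "chris' 1 1 4 z = - 2 * F1 z * (2 * c z * F z + F1 z) - 2 * F z * (2 * c1 z * F z + 2 * c z * F1 z + F2 z)"
  "chris' 1 2 1 z = 0" "chris' 1 2 2 z = 0" "chris' 1 2 3 z = - F1 z" "chris' 1 2 4 z = 0"
  "chris' 1 3 1 z = 0" "chris' 1 3 2 z = F1 z" "chris' 1 3 3 z = 0" "chris' 1 3 4 z = 0"
  "chris' 1 4 1 z = c1 z + (F2 z * F z - (F1 z)\<^sup>2) / (2 * (F z)\<^sup>2)" "chris' 1 4 2 z = 0"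
  "chris' 1 4 3 z = 0" "chris' 1 4 4 z = 0" "chris' 2 1 1 z = 0" "chris' 2 1 2 z = 0"
  "chris' 2 1 3 z = - F1 z" "chris' 2 1 4 z = 0" "chris' 2 2 1 z = 0" "chris' 2 2 2 z = 0"
  "chris' 2 2 3 z = 0" "chris' 2 2 4 z = - 4 * F1 z * c z - 4 * F z * c1 z" "chris' 2 3 1 z = 0"
  "chris' 2 3 2 z = 0" "chris' 2 3 3 z = 0" "chris' 2 3 4 z = 0" "chris' 2 4 1 z = 0"
  "chris' 2 4 2 z = c1 z" "chris' 2 4 3 z = 0" "chris' 2 4 4 z = 0" "chris' 3 1 1 z = 0"
  "chris' 3 1 2 z = F1 z" "chris' 3 1 3 z = 0" "chris' 3 1 4 z = 0" "chris' 3 2 1 z = 0"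
  "chris' 3 2 2 z = 0" "chris' 3 2 3 z = 0" "chris' 3 2 4 z = 0" "chris' 3 3 1 z = 0" "chris' 3 3 2 z = 0"
  "chris' 3 3 3 z = 0" "chris' 3 3 4 z = - 4 * F1 z * c z - 4 * F z * c1 z" "chris' 3 4 1 z = 0"
  "chris' 3 4 2 z = 0" "chris' 3 4 3 z = c1 z" "chris' 3 4 4 z = 0"
  "chris' 4 1 1 z = c1 z + (F2 z * F z - (F1 z)\<^sup>2) / (2 * (F z)\<^sup>2)" "chris' 4 1 2 z = 0"
  "chris' 4 1 3 z = 0" "chris' 4 1 4 z = 0" "chris' 4 2 1 z = 0" "chris' 4 2 2 z = c1 z"
  "chris' 4 2 3 z = 0" "chris' 4 2 4 z = 0" "chris' 4 3 1 z = 0" "chris' 4 3 2 z = 0"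
  "chris' 4 3 3 z = c1 z" "chris' 4 3 4 z = 0" "chris' 4 4 1 z = 0" "chris' 4 4 2 z = 0"
  "chris' 4 4 3 z = 0" "chris' 4 4 4 z = c1 z - (F2 z * F z - (F1 z)\<^sup>2) / (2 * (F z)\<^sup>2)"
  by (simp_all add: chris'_def)

lemma chris_deriv:
  assumes z: "z \<in> I" shows "(chris i j k has_real_derivative chris' i j k z) (at z)"
proof -
  have "((\<lambda>x. chris i j k x) has_real_derivative chris' i j k z) (at z)"
    using exhaust_4[of i] exhaust_4[of j] exhaust_4[of k] F_pos[OF z]
    by (elim disjE; hypsubst; simp only: chris_table chris'_table)
      (auto intro!: derivative_eq_intros has_derivs z simp: field_simps power2_eq_square)
  then show ?thesis .
qed

lemma frame_conn:
  assumes "z \<in> I"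
  shows "frame a (conn g i j k) (z, q) = (if a = 4 then chris' i j k z else 0)"
  by (rule frame_at[where I = I and h = "chris i j k"]) (use assms open_I chris_deriv conn_eq in auto)

definition riem_comp :: "4 \<Rightarrow> 4 \<Rightarrow> 4 \<Rightarrow> 4 \<Rightarrow> real \<Rightarrow> real" where
  "riem_comp i j k l z = ((if i = 4 then chris' j k l z else 0) - (if j = 4 then chris' i k l z else 0)
     + (\<Sum>m\<in>UNIV. chris j k m z * chris i m l z - chris i k m z * chris j m l z
                    - struct_const i j m * chris m k l z)) * gdiag l z"

lemma riemann_eq: 
  assumes z: "z \<in> I" shows "riemann g i j k l (z, q) = riem_comp i j k l z"
  unfolding riemann_def riemann_up_def frame_conn[OF z] conn_eq[OF z] metric_entry riem_comp_def
  by (simp add: if_distrib[of "\<lambda>x. _ * x"] cong: if_cong)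

definition ricci_comp :: "4 \<Rightarrow> real \<Rightarrow> real" where
  "ricci_comp i z =
    (if i = 1 then 2 * F z * (F z - F2 z - 2 * F z * c1 z - 4 * F z * (c z)\<^sup>2 - 4 * c z * F1 z)
     else if i = 4 then (- F2 z - 6 * F z * c1 z - 4 * c z * F1 z) / (2 * F z)
     else 4 - 2 * F z - 4 * F z * c1 z - 8 * F z * (c z)\<^sup>2 - 4 * c z * F1 z)"

lemma ricci_eq:
  assumes z: "z \<in> I" shows "ricci g i j (z, q) = (if i = j then ricci_comp i z else 0)"
proof -
  have "ricci g i j (z, q) = (\<Sum>a\<in>UNIV. riem_comp a i j a z / gdiag a z)"
    unfolding ricci_def riemann_eq[OF z] inverse_entry[OF z]
    by (simp add: if_distrib[of "\<lambda>x. x * _"] cong: if_cong)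
  also have "\<dots> = (if i = j then ricci_comp i z else 0)"
    unfolding riem_comp_def sum_4
    using exhaust_4[of i] exhaust_4[of j] F_pos[OF z] C_pos[OF z]
    by (elim disjE; hypsubst)
      (simp_all add: struct_const_table chris_table chris'_table gdiag_table ricci_comp_def field_simps power2_eq_square)
  finally show ?thesis .
qed

definition scal_comp :: "real \<Rightarrow> real" where
  "scal_comp z = (8 - 2 * F z - 4 * F2 z - 24 * F z * (c1 z + (c z)\<^sup>2) - 24 * c z * F1 z) / C z"

lemma scal_eq:
  assumes z: "z \<in> I" shows "scal g (z, q) = scal_comp z"
  unfolding scal_def inverse_entry[OF z] ricci_eq[OF z] sum_4 scal_comp_def
  using F_pos[OF z] C_pos[OF z]
  by (simp add: gdiag_def ricci_comp_def field_simps power2_eq_square)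

text \<open>
Both halves of the Weyl tensor are invariant under the rotations about $e_1$, so each has a double
eigenvalue, and the third eigenvalue is $-2$ times that one. The planes $e_1 \wedge e_4$ and
$e_2 \wedge e_3$ belong to the third eigenvalue and get the weight 1.
\<close>

definition plane_weight :: "4 \<Rightarrow> 4 \<Rightarrow> real" where
  "plane_weight i j = (if (i, j) \<in> {(1, 4), (4, 1), (2, 3), (3, 2)} then 1 else - 1 / 2)"

definition index :: "4 \<Rightarrow> real" where
  "index i = (if i = 1 then 1 else if i = 2 then 2 else if i = 3 then 3 else 4)"

text \<open>
The Vandermonde product of four indices from 1 to 4 is 12 times the sign of the permutation, and zero if
an index repeats.
\<close>

definition levi_civita :: "4 \<Rightarrow> 4 \<Rightarrow> 4 \<Rightarrow> 4 \<Rightarrow> real" where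
  "levi_civita i j k l = (index j - index i) * (index k - index i) * (index l - index i)
     * (index k - index j) * (index l - index j) * (index l - index k) / 12"

text \<open>
The squared length of $e_i$ in the metric with \<open>C = 1\<close>.
\<close>

definition weight :: "4 \<Rightarrow> real \<Rightarrow> real" where
  "weight i z = (if i = 1 then F z else if i = 4 then 1 / (4 * F z) else 1)"

lemma weight_table: "weight 1 z = F z" "weight 2 z = 1" "weight 3 z = 1" "weight 4 z = 1 / (4 * F z)"
  by (simp_all add: weight_def)

text \<open>
The only trace of the conformal factor in the Weyl tensor is the overall \<open>C\<close>; this keeps the derivatives
of \<open>c\<close> out of the divergence of the Weyl tensor, and \<open>c'\<close> is enough for the Bach tensor.
\<close>

definition weyl_comp :: "4 \<Rightarrow> 4 \<Rightarrow> 4 \<Rightarrow> 4 \<Rightarrow> real \<Rightarrow> real" where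
  "weyl_comp i j k l z = plane_weight i j * C z *
     (levi_civita i j k l * F1 z - 2 / 3 * (F2 z + 2 * F z - 2) * weight i z * weight j z *
         ((if i = l \<and> j = k then 1 else 0) - (if i = k \<and> j = l then 1 else 0)))"

text \<open>
The decomposition of the curvature tensor into Weyl and Ricci parts, for a diagonal Ricci tensor.
Evaluation at all 256 index tuples settles it; the zero components are removed first because
clearing denominators is expensive.
\<close>

lemma riem_comp_table:
  assumes z: "z \<in> I"
  shows "riem_comp i j k l z = weyl_comp i j k l z
     + ((if i = l \<and> j = k then 1 else 0) - (if i = k \<and> j = l then 1 else 0))
       * ((gdiag i z * ricci_comp j z + gdiag j z * ricci_comp i z) / 2 - scal_comp z / 6 * gdiag i z * gdiag j z)"
  using exhaust_4[of i] exhaust_4[of j] exhaust_4[of k] exhaust_4[of l] F_pos[OF z] C_pos[OF z]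
  unfolding riem_comp_def sum_4
  by ((elim disjE; hypsubst),
      (simp_all only: struct_const_table chris_table chris'_table plane_weight_def levi_civita_def index_def weyl_comp_def),
      simp_all,
      (simp_all add: scal_comp_def gdiag_table weight_table ricci_comp_def field_simps power2_eq_square))

lemma weyl_eq:
  assumes z: "z \<in> I" shows "weyl g i j k l (z, q) = weyl_comp i j k l z"
  unfolding weyl_def riemann_eq[OF z] ricci_eq[OF z] scal_eq[OF z] metric_entry riem_comp_table[OF z]
  by (auto simp: field_simps)

end

section \<open>The Bach tensor\<close>

lemma cov_deriv_rank4:
  "cov_deriv G T [k, a, b, d, e] p = frame k (T [a, b, d, e]) p
    - (\<Sum>l\<in>UNIV. conn G k a l p * T [l, b, d, e] p + conn G k b l p * T [a, l, d, e] p
        + conn G k d l p * T [a, b, l, e] p + conn G k e l p * T [a, b, d, l] p)"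
proof -
  have "{..<length [a, b, d, e]} = {0, 1, 2, 3}" by auto
  then show ?thesis
    by (simp add: sum.distrib numeral_eq_Suc)
qed

lemma cov_deriv_rank5:
  "cov_deriv G T [k, a, b, d, e, f] p = frame k (T [a, b, d, e, f]) p
    - (\<Sum>l\<in>UNIV. conn G k a l p * T [l, b, d, e, f] p + conn G k b l p * T [a, l, d, e, f] p
        + conn G k d l p * T [a, b, l, e, f] p + conn G k e l p * T [a, b, d, l, f] p
        + conn G k f l p * T [a, b, d, e, l] p)"
proof -
  have "{..<length [a, b, d, e, f]} = {0, 1, 2, 3, 4}" by auto
  then show ?thesis
    by (simp add: sum.distrib numeral_eq_Suc)
qed

context U2_geometry begin

definition weight' :: "4 \<Rightarrow> real \<Rightarrow> real" where
  "weight' i z = (if i = 1 then F1 z else if i = 4 then - F1 z / (4 * (F z)\<^sup>2) else 0)"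

lemma weight'_table: "weight' 1 z = F1 z" "weight' 2 z = 0" "weight' 3 z = 0" "weight' 4 z = - F1 z / (4 * (F z)\<^sup>2)"
  by (simp_all add: weight'_def)

lemma weight_deriv: "z \<in> I \<Longrightarrow> (weight i has_real_derivative weight' i z) (at z)"
  using F_pos[of z] unfolding weight_def[abs_def] weight'_def
  by (auto intro!: derivative_eq_intros has_derivs simp: field_simps power2_eq_square)

definition weyl_comp' :: "4 \<Rightarrow> 4 \<Rightarrow> 4 \<Rightarrow> 4 \<Rightarrow> real \<Rightarrow> real" where
  "weyl_comp' i j k l z = 2 * c z * weyl_comp i j k l z + plane_weight i j * C z *
     (levi_civita i j k l * F2 z
       - 2 / 3 * ((F3 z + 2 * F1 z) * weight i z * weight j z
                + (F2 z + 2 * F z - 2) * (weight' i z * weight j z + weight i z * weight' j z)) *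
         ((if i = l \<and> j = k then 1 else 0) - (if i = k \<and> j = l then 1 else 0)))"

lemma weyl_comp_deriv: "z \<in> I \<Longrightarrow> (weyl_comp i j k l has_real_derivative weyl_comp' i j k l z) (at z)"
  unfolding weyl_comp_def[abs_def] weyl_comp'_def
  by (rule derivative_eq_intros has_derivs weight_deriv[THEN DERIV_cong] refl | assumption)+
    (simp add: algebra_simps)

definition nabla_weyl_comp :: "4 \<Rightarrow> 4 \<Rightarrow> 4 \<Rightarrow> 4 \<Rightarrow> 4 \<Rightarrow> real \<Rightarrow> real" where
  "nabla_weyl_comp m i j k l z = (if m = 4 then weyl_comp' i j k l z else 0)
    - (\<Sum>n\<in>UNIV. chris m i n z * weyl_comp n j k l z + chris m j n z * weyl_comp i n k l z
        + chris m k n z * weyl_comp i j n l z + chris m l n z * weyl_comp i j k n z)"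

lemma nabla_weyl_eq:
  assumes z: "z \<in> I"
  shows "cov_deriv g (weyl_tensor g) [m, i, j, k, l] (z, q) = nabla_weyl_comp m i j k l z"
proof -
  have W: "weyl_tensor g [i, j, k, l] (x, q) = weyl_comp i j k l x" if "x \<in> I" for i j k l x q
    using weyl_eq[OF that] by (simp add: weyl_tensor_def numeral_eq_Suc)
  have "frame m (weyl_tensor g [i, j, k, l]) (z, q) = (if m = 4 then weyl_comp' i j k l z else 0)"
    by (rule frame_at[where I = I and h = "weyl_comp i j k l"]) (use z open_I weyl_comp_deriv W in auto)
  then show ?thesis
    unfolding cov_deriv_rank4 nabla_weyl_comp_def by (simp add: W[OF z] conn_eq[OF z])
qed

lemma nabla_weyl_comp_deriv: 
  assumes z: "z \<in> I" 
  shows "\<exists>D. (nabla_weyl_comp m i j k l has_real_derivative D) (at z)"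
proof -
  have [derivative_intros]: "F field_differentiable at z" "F1 field_differentiable at z"
    "F2 field_differentiable at z" "F3 field_differentiable at z"
    "C field_differentiable at z" "c field_differentiable at z" 
    "chris i j k field_differentiable at z" "weyl_comp i j k l field_differentiable at z" 
    "weight i field_differentiable at z" for i j k l
    using z dF dF1 dF2 dF3 dC dc chris_deriv weyl_comp_deriv weight_deriv 
    by (meson field_differentiable_def)+
  have [derivative_intros]: "weight' i field_differentiable at z" for i
    using F_pos[OF z] unfolding weight'_def[abs_def] 
    by (cases "i = 1"; cases "i = 4"; simp) (intro derivative_intros; simp)+
  have [derivative_intros]: "weyl_comp' i j k l field_differentiable at z" for i j k l
    unfolding weyl_comp'_def[abs_def] by (intro derivative_intros)
  have "(nabla_weyl_comp m i j k l) field_differentiable at z"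
    unfolding nabla_weyl_comp_def[abs_def] by (cases "m = 4"; simp; intro derivative_intros)
  then show ?thesis by (simp add: field_differentiable_def)
qed

text \<open>
The divergence of the Weyl tensor over its first index. It is skew in the last two indices, and the
eigenvalue pattern of the Weyl tensor leaves two independent functions: one for the components with an
index 4, and one for those with the indices 1, 2, 3.
\<close>

definition div_weyl_comp :: "4 \<Rightarrow> 4 \<Rightarrow> 4 \<Rightarrow> real \<Rightarrow> real" where
  "div_weyl_comp i j t z = plane_weight i 4 * (levi_civita i j t 4 * 2 * F z * (2 * F z - 2 - F2 z - 2 * c z * F1 z)
     - 1 / 3 * weight i z * (2 * F3 z - 5 * F1 z + 2 * c z * (F2 z + 2 * F z - 2))
        * ((if i = j \<and> t = 4 then 1 else 0) - (if i = t \<and> j = 4 then 1 else 0)))"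

lemma div_weyl_comp_eq:
  assumes z: "z \<in> I"
  shows "(\<Sum>s\<in>UNIV. nabla_weyl_comp s s i j t z / gdiag s z) = div_weyl_comp i j t z"
  using exhaust_4[of i] exhaust_4[of j] exhaust_4[of t] F_pos[OF z] C_pos[OF z]
  unfolding nabla_weyl_comp_def sum_4
  by ((elim disjE; hypsubst),
      (simp_all only: chris_table mult_zero_left add_0_left add_0_right div_weyl_comp_def),
      (simp_all add: weyl_comp_def weyl_comp'_def plane_weight_def levi_civita_def index_def),
      (simp_all add: weight_table weight'_table gdiag_table),
      (simp_all add: field_simps power2_eq_square))

end

lemma sum_two_deltas:
  fixes s t :: "'a::finite" and X :: "'a \<Rightarrow> 'a \<Rightarrow> real"
  shows "(\<Sum>k\<in>UNIV. \<Sum>l\<in>UNIV. (if s = k then u else 0) * (if t = l then v else 0) * X k l)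
    = u * v * X s t"
proof -
  have "(\<Sum>l\<in>UNIV. (if s = k then u else 0) * (if t = l then v else 0) * X k l)
      = (if s = k then u * v * X k t else 0)" for k
    by (simp add: if_distrib[of "\<lambda>x. _ * x"] if_distrib[of "\<lambda>x. x * _"] cong: if_cong)
  then show ?thesis by simp
qed

context U2_geometry begin

definition div_weyl_comp' :: "4 \<Rightarrow> 4 \<Rightarrow> 4 \<Rightarrow> real \<Rightarrow> real" where
  "div_weyl_comp' i j t z = plane_weight i 4 *
    (levi_civita i j t 4 * 2 * (F1 z * (2 * F z - 2 - F2 z - 2 * c z * F1 z)
        + F z * (2 * F1 z - F3 z - 2 * c1 z * F1 z - 2 * c z * F2 z))
     - (weight' i z * (2 * F3 z - 5 * F1 z + 2 * c z * (F2 z + 2 * F z - 2))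
         + weight i z * (2 * F4 z - 5 * F2 z + 2 * c1 z * (F2 z + 2 * F z - 2)
             + 2 * c z * (F3 z + 2 * F1 z))) / 3
        * ((if i = j \<and> t = 4 then 1 else 0) - (if i = t \<and> j = 4 then 1 else 0)))"

lemma div_weyl_comp_deriv: "z \<in> I \<Longrightarrow> (div_weyl_comp i j t has_real_derivative div_weyl_comp' i j t z) (at z)"
  unfolding div_weyl_comp_def[abs_def] div_weyl_comp'_def
  by (rule derivative_eq_intros has_derivs weight_deriv[THEN DERIV_cong] refl | assumption)+
    (simp add: field_simps split del: if_split)

text \<open>
Metric compatibility of the connection in terms of the inverse metric, which is what the contraction
of a covariant derivative uses.
\<close>

lemma metric_compatible:
  assumes z: "z \<in> I"
  shows "chris t i j z / gdiag i z + chris t j i z / gdiag j z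
    = (if t = 4 \<and> i = j then gdiag' i z / (gdiag i z)\<^sup>2 else 0)"
  using exhaust_4[of i] exhaust_4[of j] exhaust_4[of t] F_pos[OF z] C_pos[OF z]
  by (elim disjE; hypsubst) (simp_all add: chris_table gdiag'_table gdiag_table field_simps power2_eq_square)

text \<open>
Contraction commutes with the covariant derivative, so the second covariant derivatives of the Weyl
tensor, contracted over the first pair, are first covariant derivatives of its divergence. This
reduces the Bach tensor to the 64 components of the divergence.
\<close>

lemma contracted_hessian_weyl:
  assumes z: "z \<in> I"
  shows "(\<Sum>s\<in>UNIV. cov_deriv g (cov_deriv g (weyl_tensor g)) [t, s, s, i, j, r] (z, q) / gdiag s z)
    = (if t = 4 then div_weyl_comp' i j r z else 0)
      - (\<Sum>l\<in>UNIV. chris t i l z * div_weyl_comp l j r z + chris t j l z * div_weyl_comp i l r z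
           + chris t r l z * div_weyl_comp i j l z)"
proof -
  obtain D where D: "\<And>s. (nabla_weyl_comp s s i j r has_real_derivative D s) (at z)"
    using choice[of "\<lambda>s D. (nabla_weyl_comp s s i j r has_real_derivative D) (at z)"] nabla_weyl_comp_deriv[OF z] by blast
  have fr: "frame t (cov_deriv g (weyl_tensor g) [s, s, i, j, r]) (z, q) = (if t = 4 then D s else 0)"
    for s
    by (rule frame_at[where I = I and h = "nabla_weyl_comp s s i j r"])
      (use z open_I nabla_weyl_eq D in auto)
  have gdiag_nz: "gdiag s z \<noteq> 0" for s using gdiag_pos[OF z, of s] by simp
  have "((\<lambda>x. \<Sum>s\<in>UNIV. nabla_weyl_comp s s i j r x / gdiag s x) has_real_derivative
      (\<Sum>s\<in>UNIV. D s / gdiag s z - nabla_weyl_comp s s i j r z * (gdiag' s z / (gdiag s z)\<^sup>2))) (at z)"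
    by (rule derivative_eq_intros D gdiag_deriv[THEN DERIV_cong] gdiag_nz z refl sum.cong)+
      (simp add: gdiag_nz field_simps power2_eq_square)
  moreover have "((\<lambda>x. \<Sum>s\<in>UNIV. nabla_weyl_comp s s i j r x / gdiag s x) has_real_derivative div_weyl_comp' i j r z) (at z)"
    using div_weyl_comp_deriv[OF z] 
    by (rule has_field_derivative_transform_within_open[where S = I]) (use z open_I div_weyl_comp_eq in auto)
  ultimately have 1: "(\<Sum>s\<in>UNIV. D s / gdiag s z) = div_weyl_comp' i j r z + (\<Sum>s\<in>UNIV. nabla_weyl_comp s s i j r z * (gdiag' s z / (gdiag s z)\<^sup>2))"
    using DERIV_unique by (fastforce simp: sum_subtractf)
  have "(\<Sum>s\<in>UNIV. \<Sum>l\<in>UNIV. chris t s l z * (nabla_weyl_comp l s i j r z + nabla_weyl_comp s l i j r z) / gdiag s z)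
      = (\<Sum>s\<in>UNIV. \<Sum>l\<in>UNIV. nabla_weyl_comp l s i j r z * (chris t s l z / gdiag s z))
        + (\<Sum>s\<in>UNIV. \<Sum>l\<in>UNIV. nabla_weyl_comp s l i j r z * (chris t s l z / gdiag s z))"
    by (simp add: sum.distrib[symmetric] algebra_simps add_divide_distrib)
  also have "(\<Sum>s\<in>UNIV. \<Sum>l\<in>UNIV. nabla_weyl_comp s l i j r z * (chris t s l z / gdiag s z))
      = (\<Sum>s\<in>UNIV. \<Sum>l\<in>UNIV. nabla_weyl_comp l s i j r z * (chris t l s z / gdiag l z))"
    by (rule sum.swap)
  also have "(\<Sum>s\<in>UNIV. \<Sum>l\<in>UNIV. nabla_weyl_comp l s i j r z * (chris t s l z / gdiag s z)) + \<dots>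
      = (\<Sum>s\<in>UNIV. \<Sum>l\<in>UNIV. nabla_weyl_comp l s i j r z * (chris t s l z / gdiag s z + chris t l s z / gdiag l z))"
    by (simp add: sum.distrib[symmetric] distrib_left)
  also have "\<dots> = (if t = 4 then \<Sum>s\<in>UNIV. nabla_weyl_comp s s i j r z * (gdiag' s z / (gdiag s z)\<^sup>2) else 0)"
    unfolding metric_compatible[OF z] by (simp add: if_distrib[of "\<lambda>x. _ * x"] cong: if_cong)
  finally have 2: "(\<Sum>s\<in>UNIV. \<Sum>l\<in>UNIV. chris t s l z * (nabla_weyl_comp l s i j r z + nabla_weyl_comp s l i j r z) / gdiag s z)
     = (if t = 4 then \<Sum>s\<in>UNIV. nabla_weyl_comp s s i j r z * (gdiag' s z / (gdiag s z)\<^sup>2) else 0)" .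
  have 3: "(\<Sum>l\<in>UNIV. chris t i l z * div_weyl_comp l j r z + chris t j l z * div_weyl_comp i l r z + chris t r l z * div_weyl_comp i j l z)
     = (\<Sum>s\<in>UNIV. \<Sum>l\<in>UNIV. (chris t i l z * nabla_weyl_comp s s l j r z + chris t j l z * nabla_weyl_comp s s i l r z
        + chris t r l z * nabla_weyl_comp s s i j l z) / gdiag s z)"
    unfolding div_weyl_comp_eq[OF z, symmetric] sum_distrib_left
    by (subst sum.swap) (simp add: sum.distrib[symmetric] sum_distrib_left add_divide_distrib)
  have "(\<Sum>s\<in>UNIV. cov_deriv g (cov_deriv g (weyl_tensor g)) [t, s, s, i, j, r] (z, q) / gdiag s z)
     = (if t = 4 then \<Sum>s\<in>UNIV. D s / gdiag s z else 0)
       - (\<Sum>s\<in>UNIV. \<Sum>l\<in>UNIV. chris t s l z * (nabla_weyl_comp l s i j r z + nabla_weyl_comp s l i j r z) / gdiag s z)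
       - (\<Sum>s\<in>UNIV. \<Sum>l\<in>UNIV. (chris t i l z * nabla_weyl_comp s s l j r z + chris t j l z * nabla_weyl_comp s s i l r z
        + chris t r l z * nabla_weyl_comp s s i j l z) / gdiag s z)"
    unfolding cov_deriv_rank5 fr nabla_weyl_eq[OF z] conn_eq[OF z]
    by (simp add: sum.distrib sum_subtractf diff_divide_distrib add_divide_distrib sum_divide_distrib distrib_left)
  then show ?thesis unfolding 1 2 3 by simp
qed

text \<open>
The Hamiltonian of the Lagrangian \<open>(F'' + 2 (F - 1))\<^sup>2 + 9 F'\<^sup>2\<close>, to which \<open>|W|\<^sup>2\<close> reduces up to a factor.
\<close>

definition energy :: "real \<Rightarrow> real" where
  "energy z = (F2 z)\<^sup>2 - 2 * F1 z * F3 z + 5 * (F1 z)\<^sup>2 - 4 * (F z - 1)\<^sup>2"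

text \<open>
Half of the Euler-Lagrange operator of the same Lagrangian. Its zeros are the functions
$1 + \frac12 C_1 e^{-2z} + C_2 e^{-z} + C_3 e^{z} + \frac12 C_4 e^{2z}$.
\<close>

definition extremal_op :: "real \<Rightarrow> real" where
  "extremal_op z = F4 z - 5 * F2 z + 4 * F z - 4"

definition bach_comp :: "4 \<Rightarrow> real \<Rightarrow> real" where
  "bach_comp i z = 2 / 3 * weight i z / C z *
     (if i = 4 then energy z else if i = 1 then energy z - 4 * F z * extremal_op z else 2 * F z * extremal_op z - energy z)"

text \<open>
Varying the coefficient of $dz^2$ alone gives the Hamiltonian, which is the entry for $e_4$; varying
\<open>F\<close> gives the difference of the entries for $e_4$ and $e_1$; the trace vanishes. The proof evaluates
the contracted formula directly.
\<close>

lemma bach_eq: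
  assumes z: "z \<in> I"
  shows "bach g i j (z, q) = (if i = j then bach_comp i z else 0)"
proof -
  have "bach g i j (z, q) = (\<Sum>s\<in>UNIV. \<Sum>t\<in>UNIV. 1 / gdiag s z * (1 / gdiag t z) *
        (cov_deriv g (cov_deriv g (weyl_tensor g)) [t, s, s, i, j, t] (z, q)
         + 1/2 * weyl_comp s i j t z * (if s = t then ricci_comp s z else 0)))"
    unfolding bach_def inverse_entry[OF z] weyl_eq[OF z] ricci_eq[OF z]
    sum_two_deltas by (simp del: cov_deriv.simps add: mult.assoc)
  also have "\<dots> = (\<Sum>t\<in>UNIV. \<Sum>s\<in>UNIV. 1 / gdiag s z * (1 / gdiag t z) *
        (cov_deriv g (cov_deriv g (weyl_tensor g)) [t, s, s, i, j, t] (z, q)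
         + 1/2 * weyl_comp s i j t z * (if s = t then ricci_comp s z else 0)))"
    by (rule sum.swap)
  also have "\<dots> = (\<Sum>t\<in>UNIV. (\<Sum>s\<in>UNIV. cov_deriv g (cov_deriv g (weyl_tensor g)) [t, s, s, i, j, t] (z, q) / gdiag s z) / gdiag t z
      + weyl_comp t i j t z * ricci_comp t z / (2 * (gdiag t z)\<^sup>2))"
    by (simp add: sum_divide_distrib distrib_left add_divide_distrib sum.distrib power2_eq_square mult_ac
        if_distrib[of "\<lambda>x. _ * x"] if_distrib[of "\<lambda>x. x / _"]
        del: cov_deriv.simps cong: if_cong)
  also have "\<dots> = (if i = j then bach_comp i z else 0)"
    unfolding contracted_hessian_weyl[OF z] sum_4
    using exhaust_4[of i] exhaust_4[of j] F_pos[OF z] C_pos[OF z]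
    by ((elim disjE; hypsubst),
      (simp_all only: chris_table mult_zero_left add_0_left add_0_right div_weyl_comp_def div_weyl_comp'_def),
      (simp_all add: weyl_comp_def plane_weight_def levi_civita_def index_def),
      (simp_all add: weight_table weight'_table gdiag_table bach_comp_def energy_def extremal_op_def ricci_comp_def field_simps power2_eq_square))
  finally show ?thesis .
qed

end

section \<open>The $B^t$ equations for constant scalar curvature\<close>

lemma cylinder_pole: "(z, 1, 0) \<in> cylinder I \<longleftrightarrow> z \<in> I"
  by (simp add: cylinder_def)

lemma cylinder_fst: "p \<in> cylinder I \<Longrightarrow> fst p \<in> I"
  by (auto simp: cylinder_def)

context U2_geometry begin

text \<open>
Differences of eigenvalues of the Ricci tensor: up to the factor \<open>1 / C\<close>, the eigenvalue for $e_4$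
exceeds the one for $e_1$ by \<open>8 F gap41\<close>, and the one for $e_1$ exceeds the one for $e_2$ by \<open>2 gap12\<close>.
In terms of \<open>y = 1 / sqrt C\<close>, \<open>gap41\<close> is \<open>y''/y - 1/4\<close>.
\<close>

definition gap41 :: "real \<Rightarrow> real" where "gap41 z = (c z)\<^sup>2 - c1 z - 1 / 4"

definition gap12 :: "real \<Rightarrow> real" where "gap12 z = 2 * F z - 2 - F2 z - 2 * c z * F1 z"

lemma ricci_comp_tracefree:
  assumes z: "z \<in> I"
  shows "ricci_comp i z - scal_comp z / 4 * gdiag i z = weight i z *
    (if i = 4 then gap12 z + 6 * F z * gap41 z else if i = 1 then gap12 z - 2 * F z * gap41 z
     else - gap12 z - 2 * F z * gap41 z)"
  using F_pos[OF z] C_pos[OF z]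
  by (simp add: ricci_comp_def scal_comp_def gdiag_def weight_def gap12_def gap41_def field_simps power2_eq_square)

lemma scal_at: "p \<in> cylinder I \<Longrightarrow> scal g p = scal_comp (fst p)"
  using scal_eq cylinder_fst by (metis prod.collapse)

lemma CSC_iff: "CSC (cylinder I) g \<longleftrightarrow> (\<exists>k. \<forall>z\<in>I. scal_comp z = k)"
  unfolding CSC_def using scal_at cylinder_pole cylinder_fst by (metis fst_conv)

lemma ZSC_iff: "ZSC (cylinder I) g \<longleftrightarrow> (\<forall>z\<in>I. scal_comp z = 0)"
  unfolding ZSC_def using scal_at cylinder_pole cylinder_fst by (metis fst_conv)

lemma Einstein_iff: "Einstein (cylinder I) g \<longleftrightarrow> (\<exists>k. \<forall>z\<in>I. \<forall>i. ricci_comp i z = k * gdiag i z)"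
proof -
  have "(\<forall>i j. ricci g i j p = k * g p $ i $ j) \<longleftrightarrow> (\<forall>i. ricci_comp i (fst p) = k * gdiag i (fst p))"
    if p: "p \<in> cylinder I" for p k
  proof -
    obtain z q where zq: "p = (z, q)" by (cases p)
    then have "z \<in> I" using cylinder_fst[OF p] by simp
    then show ?thesis by (auto simp: zq ricci_eq metric_entry)
  qed
  then show ?thesis
    unfolding Einstein_def using cylinder_pole cylinder_fst by (metis fst_conv)
qed

lemma Einstein_imp_CSC:
  assumes "Einstein (cylinder I) g" shows "CSC (cylinder I) g"
proof -
  obtain k where k: "\<And>z i. z \<in> I \<Longrightarrow> ricci_comp i z = k * gdiag i z"
    using assms by (auto simp: Einstein_iff)
  have "scal_comp z = 4 * k" if z: "z \<in> I" for z
  proof -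
    have "scal_comp z = (\<Sum>i\<in>UNIV. ricci_comp i z / gdiag i z)"
      using scal_eq[OF z, of undefined] unfolding scal_def inverse_entry[OF z] ricci_eq[OF z]
      by (simp add: if_distrib[of "\<lambda>x. _ * x"] cong: if_cong)
    then show ?thesis
      using gdiag_pos[OF z] by (simp add: k[OF z] less_imp_neq[symmetric])
  qed
  then show ?thesis by (auto simp: CSC_iff)
qed

text \<open>
Bach and trace-free Ricci tensor are both diagonal and trace-free with equal entries for $e_2$ and
$e_3$. So only two equations are independent: the entry for $e_4$, and its difference to the
entry for $e_1$, where a factor \<open>F\<close> cancels.
\<close>

lemma Bt_flat_CSC_iff:
  assumes k: "\<And>z. z \<in> I \<Longrightarrow> scal_comp z = k"
  shows "Bt_flat t (cylinder I) g \<longleftrightarrow>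
    (\<forall>z\<in>I. 2 * extremal_op z = - 3 * t * k * C z * gap41 z \<and>
           4 * energy z = - 3 * t * k * C z * (gap12 z + 6 * F z * gap41 z))"
proof -
  have eq: "- 4 * bach g i j (z, q) + t * scal_sq_gradient g i j (z, q)
      = (if i = j then - 4 * bach_comp i z - 2 * t * k * (ricci_comp i z - scal_comp z / 4 * gdiag i z) else 0)"
    if "(z, q) \<in> cylinder I" for i j z q
  proof -
    have z: "z \<in> I" using that cylinder_fst by fastforce
    show ?thesis
      using scal_sq_gradient_CSC[OF open_I _ that, of g k] k scal_at cylinder_fst
      by (simp add: ricci0_def bach_eq[OF z] ricci_eq[OF z] scal_eq[OF z] metric_entry k[OF z])
  qed
  have "Bt_flat t (cylinder I) g \<longleftrightarrow>
      (\<forall>z\<in>I. \<forall>i. - 4 * bach_comp i z - 2 * t * k * (ricci_comp i z - scal_comp z / 4 * gdiag i z) = 0)"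
    (is "?L \<longleftrightarrow> ?R")
  proof
    assume ?L
    show ?R
    proof (intro ballI allI)
      fix z i assume "z \<in> I"
      then have p: "(z, 1, 0) \<in> cylinder I" by (simp add: cylinder_pole)
      have "- 4 * bach g i i (z, 1, 0) + t * scal_sq_gradient g i i (z, 1, 0) = 0"
        using \<open>?L\<close> p unfolding Bt_flat_def by blast
      then show "- 4 * bach_comp i z - 2 * t * k * (ricci_comp i z - scal_comp z / 4 * gdiag i z) = 0"
        unfolding eq[OF p] by (simp only: simp_thms if_True)
    qed
  next
    assume R: ?R
    show ?L unfolding Bt_flat_def
    proof (intro ballI allI)
      fix p i j assume p: "p \<in> cylinder I"
      show "- 4 * bach g i j p + t * scal_sq_gradient g i j p = 0"
        using p R cylinder_fst[OF p] eq[of "fst p" "snd p" i j]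
        by (simp only: prod.collapse simp_thms if_cancel)
    qed
  qed
  also have "\<dots> \<longleftrightarrow> (\<forall>z\<in>I. 2 * extremal_op z = - 3 * t * k * C z * gap41 z \<and>
           4 * energy z = - 3 * t * k * C z * (gap12 z + 6 * F z * gap41 z))"
  proof (intro ball_cong refl)
    fix z assume z: "z \<in> I"
    have w: "weight i z > 0" for i using F_pos[OF z] by (simp add: weight_def)
    have "- 4 * bach_comp i z - 2 * t * k * (ricci_comp i z - scal_comp z / 4 * gdiag i z) = - 2 / 3 * weight i z / C z *
       (if i = 4 then 4 * energy z + 3 * t * k * C z * (gap12 z + 6 * F z * gap41 z)
        else if i = 1 then 4 * energy z - 16 * F z * extremal_op z + 3 * t * k * C z * (gap12 z - 2 * F z * gap41 z)
        else 8 * F z * extremal_op z - 4 * energy z - 3 * t * k * C z * (gap12 z + 2 * F z * gap41 z))" for i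
      unfolding ricci_comp_tracefree[OF z] bach_comp_def using C_pos[OF z] by (auto simp: field_simps)
    moreover have "- 2 / 3 * weight i z / C z \<noteq> 0" for i
      using C_pos[OF z] w[of i] by simp
    ultimately have "(\<forall>i. - 4 * bach_comp i z - 2 * t * k * (ricci_comp i z - scal_comp z / 4 * gdiag i z) = 0) \<longleftrightarrow>
       (\<forall>i::4. (if i = 4 then 4 * energy z + 3 * t * k * C z * (gap12 z + 6 * F z * gap41 z)
        else if i = 1 then 4 * energy z - 16 * F z * extremal_op z + 3 * t * k * C z * (gap12 z - 2 * F z * gap41 z)
        else 8 * F z * extremal_op z - 4 * energy z - 3 * t * k * C z * (gap12 z + 2 * F z * gap41 z)) = 0)"
      by (simp only: mult_eq_0_iff simp_thms)
    also have "\<dots> \<longleftrightarrow>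
      4 * energy z + 3 * t * k * C z * (gap12 z + 6 * F z * gap41 z) = 0 \<and>
      4 * energy z - 16 * F z * extremal_op z + 3 * t * k * C z * (gap12 z - 2 * F z * gap41 z) = 0 \<and>
      8 * F z * extremal_op z - 4 * energy z - 3 * t * k * C z * (gap12 z + 2 * F z * gap41 z) = 0"
    proof -
      have "(1 :: 4) \<noteq> 4" "(2 :: 4) \<noteq> 4" "(3 :: 4) \<noteq> 4" "(2 :: 4) \<noteq> 1" "(3 :: 4) \<noteq> 1"
        by simp_all
      then show ?thesis by (simp only: forall_4 if_True if_False simp_thms) blast
    qed
    also have "\<dots> \<longleftrightarrow> 4 * energy z + 3 * t * k * C z * (gap12 z + 6 * F z * gap41 z) = 0 \<and>
       F z * (2 * extremal_op z + 3 * t * k * C z * gap41 z) = 0"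
    proof -
      have "4 * e + 3 * (y + 6 * w) = 0 \<and> 4 * e - 16 * x + 3 * (y - 2 * w) = 0
          \<and> 8 * x - 4 * e - 3 * (y + 2 * w) = 0
        \<longleftrightarrow> 4 * e + 3 * (y + 6 * w) = 0 \<and> 2 * x + 3 * w = 0" for e x y w :: real
        by auto
      from this[of "energy z" "t * k * C z * gap12 z" "t * k * C z * F z * gap41 z" "F z * extremal_op z"]
      show ?thesis by (simp only: algebra_simps)
    qed
    also have "\<dots> \<longleftrightarrow> 2 * extremal_op z = - 3 * t * k * C z * gap41 z \<and>
       4 * energy z = - 3 * t * k * C z * (gap12 z + 6 * F z * gap41 z)"
    proof -
      have "y + 3 * t * k * C z * x = 0 \<longleftrightarrow> y = - 3 * t * k * C z * x" for x y
        by auto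
      moreover have "F z \<noteq> 0" using F_pos[OF z] by simp
      ultimately show ?thesis by (simp only: mult_eq_0_iff simp_thms conj_commute)
    qed
    finally show "(\<forall>i. - 4 * bach_comp i z - 2 * t * k * (ricci_comp i z - scal_comp z / 4 * gdiag i z) = 0) \<longleftrightarrow>
       2 * extremal_op z = - 3 * t * k * C z * gap41 z \<and>
       4 * energy z = - 3 * t * k * C z * (gap12 z + 6 * F z * gap41 z)" .
  qed
  finally show ?thesis .
qed

end

section \<open>Constant scalar curvature in the conformally extremal case\<close>

lemma DERIV_of_const_on:
  assumes "open I" "z \<in> I" "\<And>x. x \<in> I \<Longrightarrow> f x = k" "(f has_real_derivative d) (at z)"
  shows "d = 0"
proof -
  have "(f has_real_derivative 0) (at z)"
    by (rule has_field_derivative_transform_within_open[OF DERIV_const assms(1,2)])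
      (use assms(3) in auto)
  then show ?thesis using DERIV_unique assms(4) by blast
qed

lemma DERIV_zero_imp_const_on:
  assumes "convex I" "\<And>x. x \<in> I \<Longrightarrow> (f has_real_derivative 0) (at x)"
  obtains k where "\<And>x. x \<in> I \<Longrightarrow> f x = k"
  using has_field_derivative_zero_constant[OF assms(1), of f] assms(2)
    has_field_derivative_at_within by metis

context U2_geometry begin

lemma energy_deriv: "z \<in> I \<Longrightarrow> (energy has_real_derivative - 2 * F1 z * extremal_op z) (at z)"
  unfolding energy_def[abs_def] extremal_op_def
  by (auto intro!: derivative_eq_intros has_derivs simp: algebra_simps power2_eq_square)

text \<open>
The identity \<open>key\<close> computes \<open>energy\<close> from the equation \<open>s = k\<close> and its first derivative. Together with
the $B^t$ equation it shows that \<open>m \<noteq> 0\<close> would make \<open>F\<close> constant, since \<open>1 + 3 t \<noteq> 0\<close>. Then \<open>C\<close> is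
constant as well, which contradicts \<open>gap41 = 0\<close>.
\<close>

lemma CSC_Bt_flat_imp_tracefree_Ricci_zero:
  assumes I: "convex I" and k: "\<And>z. z \<in> I \<Longrightarrow> scal_comp z = k" "k \<noteq> 0"
    and t: "t \<noteq> 0" "t \<noteq> - 1 / 3"
    and Q: "\<And>z. z \<in> I \<Longrightarrow> extremal_op z = 0" and Bt: "Bt_flat t (cylinder I) g"
    and z: "z \<in> I"
  shows "gap41 z = 0 \<and> gap12 z = 0"
proof -
  have A: "2 * extremal_op z = - 3 * t * k * C z * gap41 z"
    and B: "4 * energy z = - 3 * t * k * C z * (gap12 z + 6 * F z * gap41 z)" if "z \<in> I" for z
    using Bt that by (auto simp: Bt_flat_CSC_iff[OF k(1)])
  have P: "gap41 z = 0" if "z \<in> I" for z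
    using A[OF that] Q[OF that] k(2) t(1) C_pos[OF that] by simp
  have c1: "c1 z = (c z)\<^sup>2 - 1 / 4" if "z \<in> I" for z
    using P[OF that] by (simp add: gap41_def)
  have kC: "k * C z = 8 + 4 * F z - 4 * F2 z - 48 * F z * (c z)\<^sup>2 - 24 * c z * F1 z" if "z \<in> I" for z
    using k(1)[OF that] C_pos[OF that] by (simp add: scal_comp_def c1[OF that] field_simps)
  have kC': "2 * c z * k * C z = 4 * F1 z - 4 * F3 z - 48 * F1 z * (c z)\<^sup>2
      - 96 * F z * c z * c1 z - 24 * c1 z * F1 z - 24 * c z * F2 z" if z: "z \<in> I" for z
  proof -
    have "2 * c z * k * C z - (4 * F1 z - 4 * F3 z - 48 * F1 z * (c z)\<^sup>2
      - 96 * F z * c z * c1 z - 24 * c1 z * F1 z - 24 * c z * F2 z) = 0"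
    proof (rule DERIV_of_const_on[OF open_I z])
      show "((\<lambda>z. k * C z - (8 + 4 * F z - 4 * F2 z - 48 * F z * (c z)\<^sup>2 - 24 * c z * F1 z))
        has_real_derivative 2 * c z * k * C z - (4 * F1 z - 4 * F3 z - 48 * F1 z * (c z)\<^sup>2
      - 96 * F z * c z * c1 z - 24 * c1 z * F1 z - 24 * c z * F2 z)) (at z)"
        by (auto intro!: derivative_eq_intros has_derivs z simp: algebra_simps power2_eq_square)
    qed (simp add: kC)
    then show ?thesis by simp
  qed
  \<comment> \<open>The Hamiltonian is conserved along solutions of the Euler-Lagrange equation.\<close>
  obtain e where e: "\<And>z. z \<in> I \<Longrightarrow> energy z = e"
    using DERIV_zero_imp_const_on[OF I, of energy] energy_deriv Q by force
  define m where "m = - 4 * e / (3 * t * k)"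
  have m: "C z * gap12 z = m" if "z \<in> I" for z
    using B[OF that] P[OF that] e[OF that] t(1) k(2) by (simp add: m_def field_simps)
  \<comment> \<open>For \<open>y = 1 / sqrt C\<close> this is the first integral \<open>y\<^sup>2 - 4 y'\<^sup>2\<close> of \<open>y'' = y/4\<close>.\<close>
  have "((\<lambda>z. (1 - 4 * (c z)\<^sup>2) / C z) has_real_derivative 0) (at z)" if z: "z \<in> I" for z
    using C_pos[OF z] 
    by (auto intro!: derivative_eq_intros has_derivs z simp: c1[OF z] field_simps power2_eq_square)
  then obtain n where n': "\<And>z. z \<in> I \<Longrightarrow> (1 - 4 * (c z)\<^sup>2) / C z = n"
    using DERIV_zero_imp_const_on[OF I] by blast
  have n: "1 - 4 * (c z)\<^sup>2 = n * C z" if "z \<in> I" for z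
    using n'[OF that] C_pos[OF that] by (simp add: field_simps)
  have key: "energy z = m * (k / 4 - 3 * F z * n)" if z: "z \<in> I" for z
  proof -
    have "energy z = gap12 z * (k * C z / 4 - 3 * F z * (1 - 4 * (c z)\<^sup>2))"
      using kC[OF z] kC'[OF z] unfolding energy_def gap12_def c1[OF z] by algebra
    also have "\<dots> = C z * gap12 z * (k / 4 - 3 * F z * n)"
      unfolding n[OF z] by (simp add: algebra_simps)
    finally show ?thesis by (simp add: m[OF z])
  qed
  have "m = 0"
  proof (rule ccontr)
    assume m0: "m \<noteq> 0"
    have Fn: "12 * F z * n = k * (1 + 3 * t)" if z: "z \<in> I" for z
    proof -
      have "m * (k / 4 - 3 * F z * n) = - 3 * t * k * m / 4"
        using key[OF z] e[OF z] t(1) k(2) by (simp add: m_def field_simps)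
      then have "m * (12 * F z * n - k * (1 + 3 * t)) = 0" by (simp add: algebra_simps)
      then show ?thesis using m0 by simp
    qed
    have n0: "n \<noteq> 0"
    proof
      assume "n = 0"
      then have "k * (1 + 3 * t) = 0" using Fn[OF z] by simp
      then have "1 + 3 * t = 0" using k(2) by (simp only: mult_eq_0_iff simp_thms)
      then show False using t(2) by simp
    qed
    have F1_0: "F1 z = 0" if z: "z \<in> I" for z
      by (rule DERIV_of_const_on[OF open_I z, of F "k * (1 + 3 * t) / (12 * n)"])
        (use Fn n0 dF z in \<open>auto simp: field_simps\<close>)
    have F2_0: "F2 z = 0" if z: "z \<in> I" for z
      by (rule DERIV_of_const_on[OF open_I z, of F1 0]) (use F1_0 dF1 z in auto)
    have R0: "gap12 z \<noteq> 0" if z: "z \<in> I" for z using m[OF z] m0 by auto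
    have c0: "c z = 0" if z: "z \<in> I" for z
    proof -
      have "((\<lambda>z. C z * (2 * F z - 2)) has_real_derivative 2 * c z * C z * (2 * F z - 2)) (at z)"
        by (auto intro!: derivative_eq_intros has_derivs z simp: F1_0[OF z])
      then have "2 * c z * C z * (2 * F z - 2) = 0"
        by (rule DERIV_of_const_on[OF open_I z, rotated])
          (use m F1_0 F2_0 in \<open>auto simp: gap12_def\<close>)
      then show ?thesis using R0[OF z] C_pos[OF z] F1_0[OF z] F2_0[OF z] by (auto simp: gap12_def)
    qed
    have "c1 z = 0"
      by (rule DERIV_of_const_on[OF open_I z, of c 0]) (use c0 dc z in auto)
    then show False using c1[OF z] c0[OF z] by simp
  qed
  then show ?thesis using P[OF z] m[OF z] C_pos[OF z] by simp
qed

lemma CSC_iff_ZSC_or_Einstein: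
  assumes "convex I" "\<And>z. z \<in> I \<Longrightarrow> extremal_op z = 0" "t \<noteq> 0" "t \<noteq> - 1 / 3" "Bt_flat t (cylinder I) g"
  shows "CSC (cylinder I) g \<longleftrightarrow> ZSC (cylinder I) g \<or> Einstein (cylinder I) g"
proof
  assume "CSC (cylinder I) g"
  then obtain k where k: "\<And>z. z \<in> I \<Longrightarrow> scal_comp z = k" by (auto simp: CSC_iff)
  show "ZSC (cylinder I) g \<or> Einstein (cylinder I) g"
  proof (cases "k = 0")
    case True
    then show ?thesis by (simp add: ZSC_iff k)
  next
    case False
    have "ricci_comp i z = k / 4 * gdiag i z" if z: "z \<in> I" for i z
      using ricci_comp_tracefree[OF z, of i] CSC_Bt_flat_imp_tracefree_Ricci_zero[OF assms(1) k False assms(3,4,2,5) z]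
      by (simp add: k[OF z] split: if_splits)
    then show ?thesis unfolding Einstein_iff by blast
  qed
next
  assume "ZSC (cylinder I) g \<or> Einstein (cylinder I) g"
  then show "CSC (cylinder I) g" using Einstein_imp_CSC by (auto simp: ZSC_iff CSC_iff)
qed


section \<open>Conformally extremal metrics\<close>

text \<open>
Commuting with the rotation of the plane of $e_2$ and $e_3$ makes \<open>J\<close> block diagonal, with a quarter turn in
the block of $e_2, e_3$ and, by orthogonality, a quarter turn of the block of $e_1, e_4$ up to scale.
One component of $\nabla_{e_2} J = 0$ then compares the two blocks and determines \<open>c\<close> up to sign.
\<close>

lemma Kahler_components:
  assumes z: "z \<in> I" and J: "U2_invariant_endo I J"
    and K: "Kahler (cylinder I) g (\<lambda>p. J (fst p))"
  shows "J z $ 2 $ 4 = 0" "J z $ 3 $ 4 = 0" "J z $ 4 $ 4 = 0"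
    and "gdiag 1 z * (J z $ 1 $ 4)\<^sup>2 = gdiag 4 z"
    and "(c z)\<^sup>2 = 1 / 4"
proof -
  have p: "(z, 1, 0) \<in> cylinder I" using z by (simp add: cylinder_pole)
  have JJ: "(\<Sum>k\<in>UNIV. J z $ i $ k * J z $ k $ j) = (if i = j then - 1 else 0)" for i j
  proof -
    have "J z ** J z = - mat 1" using K p unfolding Kahler_def by force
    then have "(J z ** J z) $ i $ j = (- mat 1 :: real^4^4) $ i $ j" by simp
    then show ?thesis by (simp add: matrix_matrix_mult_def mat_def)
  qed
  have Jg: "(\<Sum>k\<in>UNIV. gdiag k z * J z $ k $ i * J z $ k $ j) = (if i = j then gdiag i z else 0)" for i j
  proof -
    have "transpose (J z) ** g (z, 1, 0) ** J z = g (z, 1, 0)"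
      using K p unfolding Kahler_def by force
    then have "(transpose (J z) ** g (z, 1, 0) ** J z) $ i $ j = g (z, 1, 0) $ i $ j" by simp
    then show ?thesis
      by (simp add: matrix_matrix_mult_def transpose_def metric_entry mult_ac
          if_distrib[of "\<lambda>x. _ * x"] cong: if_cong)
  qed
  have ad: "(\<Sum>k\<in>UNIV. struct_const 1 k i * J z $ k $ j) = (\<Sum>k\<in>UNIV. J z $ i $ k * struct_const 1 j k)"
    for i j
  proof -
    have "(\<chi> a b. struct_const 1 b a) ** J z = J z ** (\<chi> a b. struct_const 1 b a)"
      using J z by (simp add: U2_invariant_endo_def Let_def)
    then have "((\<chi> a b. struct_const 1 b a) ** J z) $ i $ j = (J z ** (\<chi> a b. struct_const 1 b a)) $ i $ j"
      by simp
    then show ?thesis by (simp add: matrix_matrix_mult_def)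
  qed
  show J24: "J z $ 2 $ 4 = 0" and J34: "J z $ 3 $ 4 = 0"
    using ad[of 3 4] ad[of 2 4] by (simp_all add: sum_4 struct_const_table)
  have J12: "J z $ 1 $ 2 = 0" and J13: "J z $ 1 $ 3 = 0" and J42: "J z $ 4 $ 2 = 0"
    and J43: "J z $ 4 $ 3 = 0" and J21: "J z $ 2 $ 1 = 0" and J31: "J z $ 3 $ 1 = 0"
    using ad[of 1 3] ad[of 1 2] ad[of 4 3] ad[of 4 2] ad[of 3 1] ad[of 2 1]
    by (simp_all add: sum_4 struct_const_table)
  have rot: "J z $ 2 $ 2 = J z $ 3 $ 3" "J z $ 2 $ 3 = - J z $ 3 $ 2"
    using ad[of 2 3] ad[of 2 2] unfolding sum_4 struct_const_table by linarith+
  have J32: "(J z $ 3 $ 2)\<^sup>2 = 1"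
  proof -
    have 1: "(J z $ 3 $ 3)\<^sup>2 - (J z $ 3 $ 2)\<^sup>2 = - 1" "J z $ 3 $ 2 * J z $ 3 $ 3 = 0"
      using JJ[of 3 3] JJ[of 3 2] rot J31 J43 J42 J34
      by (simp_all add: sum_4 power2_eq_square algebra_simps)
    then have "J z $ 3 $ 3 = 0"
      by (metis diff_0_right mult_eq_0_iff neg_0_le_iff_le not_one_le_zero zero_eq_power2 zero_le_power2)
    then show ?thesis using 1 by simp
  qed
  have tr: "J z $ 1 $ 4 * (J z $ 1 $ 1 + J z $ 4 $ 4) = 0"
    "(J z $ 1 $ 1)\<^sup>2 + J z $ 1 $ 4 * J z $ 4 $ 1 = - 1"
    "gdiag 1 z * J z $ 1 $ 1 * J z $ 1 $ 4 + gdiag 4 z * J z $ 4 $ 1 * J z $ 4 $ 4 = 0"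
    "gdiag 1 z * (J z $ 1 $ 4)\<^sup>2 + gdiag 4 z * (J z $ 4 $ 4)\<^sup>2 = gdiag 4 z"
    using JJ[of 1 4] JJ[of 1 1] Jg[of 1 4] Jg[of 4 4] J12 J13 J24 J34 J21 J31
    by (simp_all add: sum_4 power2_eq_square algebra_simps)
  have J14: "J z $ 1 $ 4 \<noteq> 0"
  proof
    assume "J z $ 1 $ 4 = 0"
    then have "(J z $ 1 $ 1)\<^sup>2 = - 1" using tr(2) by simp
    then show False by (metis neg_0_le_iff_le not_one_le_zero zero_le_power2)
  qed
  then have J11: "J z $ 1 $ 1 = - J z $ 4 $ 4" using tr(1) by (simp add: eq_neg_iff_add_eq_0)
  show J44: "J z $ 4 $ 4 = 0"
  proof (rule ccontr)
    assume "J z $ 4 $ 4 \<noteq> 0"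
    moreover have "J z $ 4 $ 4 * (gdiag 4 z * J z $ 4 $ 1 - gdiag 1 z * J z $ 1 $ 4) = 0"
      using tr(3) by (simp add: J11 algebra_simps)
    ultimately have "gdiag 4 z * J z $ 4 $ 1 = gdiag 1 z * J z $ 1 $ 4" by simp
    then have "gdiag 4 z * (J z $ 1 $ 4 * J z $ 4 $ 1) = gdiag 1 z * (J z $ 1 $ 4)\<^sup>2"
      by (simp add: power2_eq_square algebra_simps)
    then have "gdiag 4 z * (J z $ 1 $ 4 * J z $ 4 $ 1) \<ge> 0"
      using gdiag_pos[OF z, of 1] by simp
    then have "J z $ 1 $ 4 * J z $ 4 $ 1 \<ge> 0"
      using gdiag_pos[OF z, of 4] by (simp add: zero_le_mult_iff)
    moreover have "(J z $ 1 $ 1)\<^sup>2 \<ge> 0" by simp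
    ultimately show False using tr(2) by linarith
  qed
  show g14: "gdiag 1 z * (J z $ 1 $ 4)\<^sup>2 = gdiag 4 z" using tr(4) J44 by simp
  have "cov_deriv_endo g (\<lambda>p. J (fst p)) 2 3 4 (z, 1, 0) = 0"
    using K p unfolding Kahler_def by blast
  moreover have "frame 2 (\<lambda>x. J (fst x) $ 3 $ 4) (z, 1, 0) = 0"
    by (simp add: frame_def)
  ultimately have "F z * J z $ 1 $ 4 = - c z * J z $ 3 $ 2"
    by (simp add: cov_deriv_endo_def conn_eq[OF z] sum_4 chris_table)
  then have "(F z * J z $ 1 $ 4)\<^sup>2 = (c z * J z $ 3 $ 2)\<^sup>2" by simp
  then have "(F z)\<^sup>2 * (J z $ 1 $ 4)\<^sup>2 = (c z)\<^sup>2" by (simp add: power_mult_distrib J32)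
  moreover have "4 * (F z)\<^sup>2 * (J z $ 1 $ 4)\<^sup>2 = 1"
    using g14 F_pos[OF z] C_pos[OF z] by (simp add: gdiag_table field_simps power2_eq_square)
  ultimately show "(c z)\<^sup>2 = 1 / 4" by simp
qed

text \<open>
The field $J \nabla s$ is a function multiple of $e_1$, and \<open>L\<close> is its only covariant component. The Killing
equation for $e_1, e_4$ makes that function constant. Its sign depends on the orientation of \<open>J\<close>,
therefore its square is used: \<open>H\<^sup>2\<close> is constant for \<open>H = s'/(4 C)\<close>, and \<open>H'\<close> is
\<open>- extremal_op / C\<^sup>2\<close>.
\<close>

lemma extremal_Kahler_imp_extremal_op_zero:
  assumes I: "convex I" and J: "U2_invariant_endo I J"
    and ext: "extremal_Kahler (cylinder I) g (\<lambda>p. J (fst p))" and z: "z \<in> I"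
  shows "extremal_op z = 0"
proof -
  have K: "Kahler (cylinder I) g (\<lambda>p. J (fst p))"
    and Kill: "Killing (cylinder I) g (\<lambda>p. J (fst p) *v grad g (scal g) p)"
    using ext by (auto simp: extremal_Kahler_def)
  note J_comp = Kahler_components[OF _ J K]
  have c1: "c1 z = 0" if z: "z \<in> I" for z
  proof -
    have "2 * c z * c1 z = 0"
      by (rule DERIV_of_const_on[OF open_I z, of "\<lambda>z. (c z)\<^sup>2" "1 / 4"])
        (use z J_comp(5) in \<open>auto intro!: derivative_eq_intros has_derivs\<close>)
    moreover have "c z \<noteq> 0" using J_comp(5)[OF z] by auto
    ultimately show ?thesis by simp
  qed
  define H where "H z = (F1 z - 4 * c z * F2 z - F3 z - 4 * c z + 4 * c z * F z) / (C z)\<^sup>2" for z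
  have scal_comp_deriv: "(scal_comp has_real_derivative 4 * C z * H z) (at z)" if z: "z \<in> I" for z
  proof (rule has_field_derivative_transform_within_open[OF _ open_I z])
    show "((\<lambda>z. (8 - 8 * F z - 4 * F2 z - 24 * c z * F1 z) / C z) has_real_derivative 4 * C z * H z) (at z)"
      using C_pos[OF z] J_comp(5)[OF z] unfolding H_def
      by (auto intro!: derivative_eq_intros has_derivs z simp: c1[OF z] field_simps power2_eq_square)
  qed (simp add: scal_comp_def c1 J_comp(5))
  have H_deriv: "(H has_real_derivative - extremal_op z / (C z)\<^sup>2) (at z)" if z: "z \<in> I" for z
    using C_pos[OF z] J_comp(5)[OF z] unfolding H_def[abs_def] extremal_op_def
    by ((auto intro!: derivative_eq_intros has_derivs z simp: c1[OF z] field_simps power2_eq_square),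
        algebra)
  define L where "L z = gdiag 1 z * J z $ 1 $ 4 * (4 * C z * H z / gdiag 4 z)" for z
  have L_sq: "(L z)\<^sup>2 = (8 * F z * C z * H z)\<^sup>2" if z: "z \<in> I" for z
  proof -
    have "(L z)\<^sup>2 = gdiag 1 z * (gdiag 1 z * (J z $ 1 $ 4)\<^sup>2) * (4 * C z * H z / gdiag 4 z)\<^sup>2"
      by (simp add: L_def power2_eq_square)
    also have "\<dots> = (8 * F z * C z * H z)\<^sup>2"
      unfolding J_comp(4)[OF z] using F_pos[OF z] C_pos[OF z]
      by (simp add: gdiag_table field_simps power2_eq_square)
    finally show ?thesis .
  qed
  have grad: "grad g (scal g) (z, q) $ i = (if i = 4 then 4 * C z * H z / gdiag 4 z else 0)"
    if z: "z \<in> I" for z q i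
  proof -
    have "frame i (scal g) (z, q) = (if i = 4 then 4 * C z * H z else 0)" for i
      by (rule frame_at[where I = I and h = scal_comp]) (use z open_I scal_comp_deriv scal_eq in auto)
    then show ?thesis
      by (simp add: grad_def inverse_entry[OF z] if_distrib[of "\<lambda>x. x * _"] cong: if_cong)
  qed
  have lower: "lower g (\<lambda>p. J (fst p) *v grad g (scal g) p) [i] (z, q) = (if i = 1 then L z else 0)"
    if z: "z \<in> I" for z q i
    using exhaust_4[of i] J_comp(1-3)[OF z]
    by (auto simp: lower_def matrix_vector_mult_def metric_entry sum_4 grad[OF z] L_def)
  have J14_diff: "\<exists>D. ((\<lambda>z. J z $ 1 $ 4) has_real_derivative D) (at z)" if z: "z \<in> I" for z
    using J z unfolding U2_invariant_endo_def smooth_def 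
    by (metis DERIV_deriv_iff_real_differentiable funpow_0)
  have L_deriv: "(L has_real_derivative 2 * (c z + F1 z / (2 * F z)) * L z) (at z)" if z: "z \<in> I" for z
  proof -
    obtain j where "((\<lambda>z. J z $ 1 $ 4) has_real_derivative j) (at z)" using J14_diff[OF z] by blast
    then have "\<exists>l. (L has_real_derivative l) (at z)"
      unfolding L_def[abs_def] using gdiag_pos[OF z, of 4]
      by (intro exI) (rule derivative_eq_intros gdiag_deriv[OF z] has_derivs H_deriv z refl | assumption | simp)+
    then obtain l where l: "(L has_real_derivative l) (at z)" by blast
    have fr: "frame 4 (lower g (\<lambda>p. J (fst p) *v grad g (scal g) p) [1]) (z, 1, 0) = l"
      using frame_at[where I = I and h = L and h' = l and i = 4] lower open_I z l by simp
    have "cov_deriv g (lower g (\<lambda>p. J (fst p) *v grad g (scal g) p)) [4, 1] (z, 1, 0)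
        + cov_deriv g (lower g (\<lambda>p. J (fst p) *v grad g (scal g) p)) [1, 4] (z, 1, 0) = 0"
      using Kill z cylinder_pole unfolding Killing_def by blast
    moreover have "frame 1 (lower g (\<lambda>p. J (fst p) *v grad g (scal g) p) [4]) (z, 1, 0) = 0"
      using frame_at[where I = I and h = "\<lambda>_. 0" and h' = 0 and i = 1] lower open_I z by simp
    ultimately have "l = 2 * (c z + F1 z / (2 * F z)) * L z"
      by (simp add: fr lower[OF z] conn_eq[OF z] sum_4 chris_table)
    then show ?thesis using l by simp
  qed
  \<comment> \<open>The factor \<open>(8 F C)\<^sup>2\<close> satisfies the same linear equation as \<open>L\<^sup>2\<close>, so the quotient is constant.\<close>
  have H_sq: "((\<lambda>z. (H z)\<^sup>2) has_real_derivative 0) (at z)" if z: "z \<in> I" for z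
  proof (rule has_field_derivative_transform_within_open[OF _ open_I z])
    show "((\<lambda>z. (L z)\<^sup>2 / (8 * F z * C z)\<^sup>2) has_real_derivative 0) (at z)"
      using F_pos[OF z] C_pos[OF z]
      by (auto intro!: derivative_eq_intros has_derivs L_deriv[THEN DERIV_cong] z
          simp: field_simps power2_eq_square)
    show "(L x)\<^sup>2 / (8 * F x * C x)\<^sup>2 = (H x)\<^sup>2" if x: "x \<in> I" for x
      unfolding L_sq[OF x] using F_pos[OF x] C_pos[OF x] by (simp add: power_mult_distrib)
  qed
  obtain h where h: "\<And>x. x \<in> I \<Longrightarrow> (H x)\<^sup>2 = h"
    using DERIV_zero_imp_const_on[OF I H_sq] by blast
  \<comment> \<open>Either \<open>H\<close> vanishes on \<open>I\<close>, or it has no zero and can be cancelled from \<open>2 H H' = 0\<close>.\<close>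
  have "extremal_op z / (C z)\<^sup>2 = 0"
  proof (cases "h = 0")
    case True
    have "- extremal_op z / (C z)\<^sup>2 = 0"
      by (rule DERIV_of_const_on[OF open_I z, of H 0]) (use h True H_deriv z in auto)
    then show ?thesis by simp
  next
    case False
    have "((\<lambda>z. (H z)\<^sup>2) has_real_derivative 2 * H z * (- extremal_op z / (C z)\<^sup>2)) (at z)"
      by (auto intro!: derivative_eq_intros H_deriv[THEN DERIV_cong] z)
    then have "2 * H z * (- extremal_op z / (C z)\<^sup>2) = 0"
      using DERIV_unique H_sq[OF z] by blast
    then show ?thesis using h[OF z] False by auto
  qed
  then show ?thesis using C_pos[OF z] by simp
qed

end

lemma smooth_DERIV:
  assumes "smooth I f" "z \<in> I"
  shows "((deriv ^^ n) f has_real_derivative (deriv ^^ Suc n) f z) (at z)"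
  using assms DERIV_deriv_iff_real_differentiable by (auto simp: smooth_def)

text \<open>
A conformal multiple belongs to the same family, with the same \<open>F\<close> and another \<open>C\<close>; the equation on \<open>F\<close>
does not see the difference.
\<close>

lemma (in U2_geometry) conformally_extremal_imp_extremal_op_zero:
  assumes I: "convex I" and ext: "conformally_extremal I g" and z: "z \<in> I"
  shows "extremal_op z = 0"
proof -
  obtain u J where u: "smooth I u" "\<And>z. z \<in> I \<Longrightarrow> u z > 0" and J: "U2_invariant_endo I J"
    and ext: "extremal_Kahler (cylinder I) (\<lambda>p. u (fst p) *\<^sub>R g p) (\<lambda>p. J (fst p))"
    using ext unfolding conformally_extremal_def by blast
  have eq: "(\<lambda>p. u (fst p) *\<^sub>R g p) = U2_metric F (\<lambda>z. u z * C z)"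
    by (auto simp: U2_metric_def)
  define u1 where "u1 = deriv u"
  define u2 where "u2 = deriv u1"
  have du: "(u has_real_derivative u1 z) (at z)" "(u1 has_real_derivative u2 z) (at z)" if "z \<in> I" for z
    using smooth_DERIV[OF u(1) that, of 0] smooth_DERIV[OF u(1) that, of 1]
    by (simp_all add: u1_def u2_def)
  interpret K: U2_geometry I F F1 F2 F3 F4 "\<lambda>z. u z * C z" "\<lambda>z. u1 z / (2 * u z) + c z"
    "\<lambda>z. (u2 z * u z - (u1 z)\<^sup>2) / (2 * (u z)\<^sup>2) + c1 z"
  proof unfold_locales
    fix z assume z: "z \<in> I"
    show "((\<lambda>z. u z * C z) has_real_derivative 2 * (u1 z / (2 * u z) + c z) * (u z * C z)) (at z)"
      using u(2)[OF z]
      by (auto intro!: derivative_eq_intros has_derivs du[THEN DERIV_cong] z simp: field_simps)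
    show "((\<lambda>z. u1 z / (2 * u z) + c z) has_real_derivative
        (u2 z * u z - (u1 z)\<^sup>2) / (2 * (u z)\<^sup>2) + c1 z) (at z)"
      using u(2)[OF z]
      by (auto intro!: derivative_eq_intros has_derivs du[THEN DERIV_cong] z
          simp: field_simps power2_eq_square)
  qed (use open_I F_pos C_pos u(2) dF dF1 dF2 dF3 in auto)
  show ?thesis
    using K.extremal_Kahler_imp_extremal_op_zero[OF I J _ z] ext by (simp add: eq)
qed

section \<open>Local solutions of ordinary differential equations\<close>

text \<open>
The Picard-Lindelof theorem for autonomous equations. Composing the field with the nearest-point
projection onto the ball makes it bounded and globally Lipschitz. Truncating the time to \<open>[- h, h]\<close> turns
the integral equation into a fixed point equation for bounded continuous functions on the whole line,
with a contraction for small \<open>h\<close>. The fixed point stays in the ball, where the projection is the identity.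
\<close>

lemma picard_local_solution:
  fixes V :: "'a::euclidean_space \<Rightarrow> 'a"
  assumes r: "r > 0" and L: "L-lipschitz_on (cball x0 r) V"
  obtains h x where "h > 0" "x 0 = x0" "\<And>t. \<bar>t\<bar> < h \<Longrightarrow> x t \<in> cball x0 r"
    "\<And>t. \<bar>t\<bar> < h \<Longrightarrow> (x has_vector_derivative V (x t)) (at t)"
proof -
  define W where "W y = V (closest_point (cball x0 r) y)" for y
  have proj: "closest_point (cball x0 r) y \<in> cball x0 r" for y
    using r by (intro closest_point_in_set) auto
  have L0: "L \<ge> 0" using L by (rule lipschitz_on_nonneg)
  have W_lip: "dist (W y) (W y') \<le> L * dist y y'" for y y'
  proof -
    have "dist (W y) (W y') \<le> L * dist (closest_point (cball x0 r) y) (closest_point (cball x0 r) y')"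
      unfolding W_def by (rule lipschitz_onD[OF L proj proj])
    also have "\<dots> \<le> L * dist y y'"
      using r L0 by (intro mult_left_mono closest_point_lipschitz) auto
    finally show ?thesis .
  qed
  define M where "M = norm (V x0) + L * r"
  have M0: "M \<ge> 0" using L0 r by (simp add: M_def)
  have W_bound: "norm (W y) \<le> M" for y
  proof -
    have "dist (W y) (V x0) \<le> L * dist (closest_point (cball x0 r) y) x0"
      unfolding W_def using r by (intro lipschitz_onD[OF L proj]) auto
    also have "\<dots> \<le> L * r" using proj[of y] L0 by (intro mult_left_mono) (auto simp: dist_commute)
    finally have "norm (W y - V x0) \<le> L * r" by (simp add: dist_norm)
    then show ?thesis using norm_triangle_sub[of "W y" "V x0"] by (simp add: M_def)
  qed
  have W_cont: "continuous_on UNIV W"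
    using lipschitz_on_continuous_on[of L UNIV W] W_lip L0 by (auto simp: lipschitz_on_def)
  \<comment> \<open>The first bound makes the operator below a contraction with factor \<open>1/2\<close>, the second keeps it in the ball.\<close>
  define h where "h = min (1 / (8 * (L + 1))) (r / (4 * (M + 1)))"
  have h0: "h > 0" using r L0 M0 by (simp add: h_def)
  have hL: "4 * h * L \<le> 1 / 2"
  proof -
    have "4 * h * L \<le> 4 * (1 / (8 * (L + 1))) * L"
      using L0 by (intro mult_right_mono mult_left_mono) (auto simp: h_def)
    also have "\<dots> \<le> 1 / 2" using L0 by (simp add: field_simps)
    finally show ?thesis .
  qed
  have hM: "4 * h * M \<le> r"
  proof -
    have "4 * h * M \<le> 4 * (r / (4 * (M + 1))) * M"
      using M0 by (intro mult_right_mono mult_left_mono) (auto simp: h_def)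
    also have "\<dots> \<le> r" using M0 r by (simp add: field_simps)
    finally show ?thesis .
  qed
  \<comment> \<open>Integrals start at \<open>- h\<close>; the integral from \<open>0\<close> is a difference, for both signs of the time.\<close>
  define G where "G f t = integral {-h..t} (\<lambda>s. W (f s))" for f t
  define clamp where "clamp t = max (- h) (min h t)" for t
  have clamp_in: "clamp t \<in> {-h..h}" for t using h0 by (auto simp: clamp_def)
  define T where "T f t = x0 + G f (clamp t) - G f 0" for f t
  have Wf_cont: "continuous_on S (\<lambda>s. W (f s))" if "continuous_on UNIV f" for f :: "real \<Rightarrow> 'a" and S
    using continuous_on_compose2[OF W_cont that] continuous_on_subset by blast
  have G_bound: "norm (G f t) \<le> 2 * h * M" if "continuous_on UNIV f" "t \<in> {-h..h}" for f t
  proof -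
    have "norm (G f t) \<le> M * (t - - h)"
      unfolding G_def using that W_bound by (intro integral_bound Wf_cont) auto
    also have "\<dots> \<le> M * (2 * h)" using that M0 by (intro mult_left_mono) auto
    finally show ?thesis by (simp add: mult_ac)
  qed
  have T_dist: "dist (T f t) x0 \<le> r" if "continuous_on UNIV f" for f t
  proof -
    have "dist (T f t) x0 \<le> norm (G f (clamp t)) + norm (G f 0)"
      unfolding T_def dist_norm using norm_triangle_ineq4[of "G f (clamp t)" "G f 0"]
      by (simp add: algebra_simps)
    also have "\<dots> \<le> 4 * h * M"
      using G_bound[OF that clamp_in[of t]] G_bound[OF that, of 0] h0 by simp
    finally show ?thesis using hM by linarith
  qed
  have T_cont: "continuous_on UNIV (T f)" if f: "continuous_on UNIV f" for f
  proof -
    have "continuous_on {-h..h} (G f)"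
      unfolding G_def
      by (intro indefinite_integral_continuous_1 integrable_continuous_real Wf_cont f)
    moreover have "continuous_on UNIV clamp" unfolding clamp_def by (intro continuous_intros)
    ultimately have "continuous_on UNIV (\<lambda>t. G f (clamp t))"
      using continuous_on_compose2 clamp_in by blast
    then show ?thesis unfolding T_def by (intro continuous_intros)
  qed
  have T_bcontfun: "T (apply_bcontfun f) \<in> bcontfun" for f
  proof (rule bcontfun_normI)
    show "norm (T (apply_bcontfun f) t) \<le> norm x0 + r" for t
      using T_dist[of "apply_bcontfun f" t] norm_triangle_sub[of "T (apply_bcontfun f) t" x0]
      by (simp add: dist_norm)
  qed (simp add: T_cont)
  define \<Phi> where "\<Phi> f = Bcontfun (T (apply_bcontfun f))" for f :: "real \<Rightarrow>\<^sub>C 'a"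
  have \<Phi>_apply: "apply_bcontfun (\<Phi> f) = T (apply_bcontfun f)" for f
    unfolding \<Phi>_def using T_bcontfun by (rule Bcontfun_inverse)
  have G_diff: "dist (G (apply_bcontfun f1) t) (G (apply_bcontfun f2) t) \<le> 2 * h * L * dist f1 f2"
    if t: "t \<in> {-h..h}" for f1 f2 :: "real \<Rightarrow>\<^sub>C 'a" and t
  proof -
    have "G (apply_bcontfun f1) t - G (apply_bcontfun f2) t
        = integral {-h..t} (\<lambda>s. W (apply_bcontfun f1 s) - W (apply_bcontfun f2 s))"
      unfolding G_def by (intro integral_diff[symmetric] integrable_continuous_real Wf_cont) auto
    moreover have "norm \<dots> \<le> L * dist f1 f2 * (t - - h)"
    proof (rule integral_bound)
      show "norm (W (apply_bcontfun f1 s) - W (apply_bcontfun f2 s)) \<le> L * dist f1 f2" for s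
        using W_lip[of "apply_bcontfun f1 s" "apply_bcontfun f2 s"] dist_bounded[of f1 s f2] L0
        by (smt (verit) dist_norm mult_left_mono)
    qed (use t in \<open>auto intro!: continuous_intros Wf_cont\<close>)
    moreover have "L * dist f1 f2 * (t - - h) \<le> L * dist f1 f2 * (2 * h)"
      using t L0 by (intro mult_left_mono) auto
    ultimately show ?thesis by (simp add: dist_norm mult_ac)
  qed
  have "dist (\<Phi> f1) (\<Phi> f2) \<le> 1 / 2 * dist f1 f2" for f1 f2
  proof (rule dist_bound)
    fix t
    have "dist (apply_bcontfun (\<Phi> f1) t) (apply_bcontfun (\<Phi> f2) t)
        \<le> dist (G (apply_bcontfun f1) (clamp t)) (G (apply_bcontfun f2) (clamp t))
          + dist (G (apply_bcontfun f1) 0) (G (apply_bcontfun f2) 0)"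
      unfolding \<Phi>_apply T_def dist_norm
      using norm_triangle_ineq4[of "G (apply_bcontfun f1) (clamp t) - G (apply_bcontfun f2) (clamp t)"
          "G (apply_bcontfun f1) 0 - G (apply_bcontfun f2) 0"]
      by (simp add: algebra_simps)
    also have "\<dots> \<le> 4 * h * L * dist f1 f2"
      using G_diff[OF clamp_in[of t], of f1 f2] G_diff[of 0 f1 f2] h0 by simp
    also have "\<dots> \<le> 1 / 2 * dist f1 f2" using hL by (intro mult_right_mono) auto
    finally show "dist (apply_bcontfun (\<Phi> f1) t) (apply_bcontfun (\<Phi> f2) t) \<le> 1 / 2 * dist f1 f2" .
  qed
  then obtain f where "\<Phi> f = f"
    using banach_fix_type[of "1 / 2" \<Phi>] by auto
  then have fix_f: "apply_bcontfun f t = T (apply_bcontfun f) t" for t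
    using \<Phi>_apply[of f] by simp
  define x where "x = apply_bcontfun f"
  have x_cont: "continuous_on S x" for S by (simp add: x_def)
  have x_fix: "x t = T x t" for t using fix_f by (simp add: x_def)
  have x_in: "x t \<in> cball x0 r" for t
    using T_dist[OF x_cont, of t] x_fix[of t] by (simp add: dist_commute)
  show ?thesis
  proof
    show "h > 0" by (rule h0)
    show "x 0 = x0" by (subst x_fix) (use h0 in \<open>simp add: T_def clamp_def\<close>)
    show "x t \<in> cball x0 r" for t by (rule x_in)
    show "(x has_vector_derivative V (x t)) (at t)" if t: "\<bar>t\<bar> < h" for t
    proof -
      have t_in: "t \<in> {-h<..<h}" using t by auto
      have "(G x has_vector_derivative W (x t)) (at t within {-h..h})"
        unfolding G_def using t by (intro integral_has_vector_derivative Wf_cont x_cont) auto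
      then have "(G x has_vector_derivative W (x t)) (at t within {-h<..<h})"
        by (rule has_vector_derivative_within_subset) auto
      then have "(G x has_vector_derivative W (x t)) (at t)"
        by (simp only: at_within_open[OF t_in open_greaterThanLessThan])
      then have "((\<lambda>t. x0 + G x t - G x 0) has_vector_derivative W (x t)) (at t)"
        by (auto intro!: derivative_eq_intros)
      then have "(x has_vector_derivative W (x t)) (at t)"
      proof (rule has_vector_derivative_transform_within_open[of _ _ _ "{-h<..<h}"])
        show "x0 + G x s - G x 0 = x s" if "s \<in> {-h<..<h}" for s
          by (subst x_fix[of s]) (use that in \<open>simp add: T_def clamp_def\<close>)
      qed (use t in auto)
      then show ?thesis
        using x_in[of t] by (simp add: W_def closest_point_self)
    qed
  qed
qed

text \<open>
A Lipschitz function on a ball is bounded there, so products stay Lipschitz.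
\<close>

lemma lipschitz_on_cball_mult_ex:
  fixes f f' :: "'a::metric_space \<Rightarrow> real"
  assumes f: "\<exists>L. L-lipschitz_on (cball x0 r) f" and f': "\<exists>L. L-lipschitz_on (cball x0 r) f'"
  shows "\<exists>L. L-lipschitz_on (cball x0 r) (\<lambda>x. f x * f' x)"
proof -
  have bound: "\<exists>M\<ge>0. \<forall>x\<in>cball x0 r. \<bar>u x\<bar> \<le> M" if u: "\<exists>L. L-lipschitz_on (cball x0 r) u" for u :: "'a \<Rightarrow> real"
  proof -
    obtain L where L: "L-lipschitz_on (cball x0 r) u" using u by blast
    have "\<bar>u x\<bar> \<le> \<bar>u x0\<bar> + L * r" if x: "x \<in> cball x0 r" for x
    proof -
      have "x0 \<in> cball x0 r" using x zero_le_dist[of x0 x] by (auto simp del: zero_le_dist)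
      then have "\<bar>u x - u x0\<bar> \<le> L * dist x x0"
        using lipschitz_onD[OF L x] by (simp add: dist_real_def)
      also have "\<dots> \<le> L * r"
        using x lipschitz_on_nonneg[OF L] by (intro mult_left_mono) (auto simp: dist_commute)
      finally show ?thesis by linarith
    qed
    then show ?thesis by (intro exI[of _ "\<bar>\<bar>u x0\<bar> + L * r\<bar>"]) force
  qed
  obtain L L' where L: "L-lipschitz_on (cball x0 r) f" "L'-lipschitz_on (cball x0 r) f'" using f f' by blast
  obtain M M' where M: "M \<ge> 0" "M' \<ge> 0" "\<And>x. x \<in> cball x0 r \<Longrightarrow> \<bar>f x\<bar> \<le> M"
    "\<And>x. x \<in> cball x0 r \<Longrightarrow> \<bar>f' x\<bar> \<le> M'" using bound[OF f] bound[OF f'] by blast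
  have "(M * L' + M' * L)-lipschitz_on (cball x0 r) (\<lambda>x. f x * f' x)"
  proof (rule lipschitz_onI)
    fix x y assume xy: "x \<in> cball x0 r" "y \<in> cball x0 r"
    have "dist (f x * f' x) (f y * f' y) = \<bar>f x * (f' x - f' y) + f' y * (f x - f y)\<bar>"
      by (simp add: dist_real_def algebra_simps)
    also have "\<dots> \<le> \<bar>f x\<bar> * \<bar>f' x - f' y\<bar> + \<bar>f' y\<bar> * \<bar>f x - f y\<bar>"
      by (metis abs_mult abs_triangle_ineq)
    also have "\<dots> \<le> M * (L' * dist x y) + M' * (L * dist x y)"
      using xy M lipschitz_onD[OF L(1) xy] lipschitz_onD[OF L(2) xy]
      by (intro add_mono mult_mono) (auto simp: dist_real_def)
    finally show "dist (f x * f' x) (f y * f' y) \<le> (M * L' + M' * L) * dist x y"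
      by (simp add: algebra_simps)
  qed (use M L lipschitz_on_nonneg in \<open>auto intro!: add_nonneg_nonneg mult_nonneg_nonneg\<close>)
  then show ?thesis by blast
qed

lemma lipschitz_on_inverse_of_bounded_below:
  fixes f :: "'a::metric_space \<Rightarrow> real"
  assumes f: "\<exists>L. L-lipschitz_on S f" and e: "e > 0" "\<And>x. x \<in> S \<Longrightarrow> f x \<ge> e"
  shows "\<exists>L. L-lipschitz_on S (\<lambda>x. 1 / f x)"
proof -
  obtain L where L: "L-lipschitz_on S f" using f by blast
  have "(L / e\<^sup>2)-lipschitz_on S (\<lambda>x. 1 / f x)"
  proof (rule lipschitz_onI)
    fix x y assume xy: "x \<in> S" "y \<in> S"
    have pos: "f x > 0" "f y > 0" using e(1) e(2)[OF xy(1)] e(2)[OF xy(2)] by auto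
    have "dist (1 / f x) (1 / f y) = \<bar>f x - f y\<bar> / (f x * f y)"
      using pos by (simp add: dist_real_def field_simps abs_minus_commute abs_mult)
    also have "\<dots> \<le> (L * dist x y) / (e * e)"
      using lipschitz_onD[OF L xy] e(1) e(2)[OF xy(1)] e(2)[OF xy(2)]
      by (intro frac_le mult_mono) (auto simp: dist_real_def)
    finally show "dist (1 / f x) (1 / f y) \<le> L / e\<^sup>2 * dist x y"
      by (simp add: power2_eq_square)
  qed (use lipschitz_on_nonneg[OF L] in auto)
  then show ?thesis by blast
qed

lemma lipschitz_on_Pair_ex:
  assumes "\<exists>L. L-lipschitz_on S f" "\<exists>L. L-lipschitz_on S f'"
  shows "\<exists>L. L-lipschitz_on S (\<lambda>x. (f x, f' x))"
  using assms lipschitz_on_Pair by blast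

lemma lipschitz_on_add_diff_ex:
  fixes f f' :: "'a::metric_space \<Rightarrow> real"
  assumes "\<exists>L. L-lipschitz_on S f" "\<exists>L. L-lipschitz_on S f'"
  shows "\<exists>L. L-lipschitz_on S (\<lambda>x. f x + f' x)" "\<exists>L. L-lipschitz_on S (\<lambda>x. f x - f' x)"
  using assms lipschitz_on_add lipschitz_on_diff by blast+

text \<open>
The algebra generated by \<open>G\<close>. If it contains a derivative of each generator, it is closed
under differentiation, so all its elements are smooth. This gives the smoothness of solutions of a
rational differential equation.
\<close>

inductive_set diff_alg :: "(real \<Rightarrow> real) set \<Rightarrow> (real \<Rightarrow> real) set" for G where
  gen: "f \<in> G \<Longrightarrow> f \<in> diff_alg G"
| const: "(\<lambda>_. a) \<in> diff_alg G"
| add: "f \<in> diff_alg G \<Longrightarrow> f' \<in> diff_alg G \<Longrightarrow> (\<lambda>z. f z + f' z) \<in> diff_alg G"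
| mult: "f \<in> diff_alg G \<Longrightarrow> f' \<in> diff_alg G \<Longrightarrow> (\<lambda>z. f z * f' z) \<in> diff_alg G"

lemma diff_alg_diff: "f \<in> diff_alg G \<Longrightarrow> f' \<in> diff_alg G \<Longrightarrow> (\<lambda>z. f z - f' z) \<in> diff_alg G"
  using diff_alg.add[OF _ diff_alg.mult[OF diff_alg.const[of "- 1"]], of f G f'] by simp

lemma diff_alg_deriv:
  assumes G: "\<And>f. f \<in> G \<Longrightarrow> \<exists>f'\<in>diff_alg G. \<forall>z\<in>I. (f has_real_derivative f' z) (at z)"
    and f: "f \<in> diff_alg G"
  shows "\<exists>f'\<in>diff_alg G. \<forall>z\<in>I. (f has_real_derivative f' z) (at z)"
  using f
proof induction
  case (gen f)
  then show ?case by (rule G)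
next
  case (const a)
  show ?case by (rule bexI[OF _ diff_alg.const[of 0]]) simp
next
  case (add f1 f2)
  then obtain g1 g2 where g: "g1 \<in> diff_alg G" "g2 \<in> diff_alg G"
    "\<And>z. z \<in> I \<Longrightarrow> (f1 has_real_derivative g1 z) (at z)"
    "\<And>z. z \<in> I \<Longrightarrow> (f2 has_real_derivative g2 z) (at z)" by blast
  then show ?case
    by (intro bexI[OF _ diff_alg.add[OF g(1,2)]]) (auto intro!: derivative_eq_intros)
next
  case (mult f1 f2)
  then obtain g1 g2 where g: "g1 \<in> diff_alg G" "g2 \<in> diff_alg G"
    "\<And>z. z \<in> I \<Longrightarrow> (f1 has_real_derivative g1 z) (at z)"
    "\<And>z. z \<in> I \<Longrightarrow> (f2 has_real_derivative g2 z) (at z)" by blast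
  show ?case
    using DERIV_mult[OF g(3,4)]
    by (intro bexI[OF _ diff_alg.add[OF diff_alg.mult[OF g(1) mult(2)] diff_alg.mult[OF g(2) mult(1)]]]) auto
qed

lemma diff_alg_smooth:
  assumes I: "open I"
    and G: "\<And>f. f \<in> G \<Longrightarrow> \<exists>f'\<in>diff_alg G. \<forall>z\<in>I. (f has_real_derivative f' z) (at z)"
    and f: "f \<in> diff_alg G"
  shows "smooth I f"
proof -
  have step: "((deriv ^^ n) f has_real_derivative d) (at z)"
    if eq: "\<forall>z\<in>I. (deriv ^^ n) f z = u z" and z: "z \<in> I" and u: "(u has_real_derivative d) (at z)"
    for n u z d
    by (rule has_field_derivative_transform_within_open[OF u I z]) (use eq in simp)
  have iter: "\<exists>u\<in>diff_alg G. \<forall>z\<in>I. (deriv ^^ n) f z = u z" for n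
  proof (induction n)
    case 0
    then show ?case using f by auto
  next
    case (Suc n)
    then obtain u where u: "u \<in> diff_alg G" "\<forall>z\<in>I. (deriv ^^ n) f z = u z" by blast
    obtain u' where u': "u' \<in> diff_alg G" "\<forall>z\<in>I. (u has_real_derivative u' z) (at z)"
      using diff_alg_deriv[OF G u(1)] by blast
    have "\<forall>z\<in>I. (deriv ^^ Suc n) f z = u' z"
      using step[OF u(2)] u'(2) by (auto intro!: DERIV_imp_deriv)
    then show ?case using u'(1) by blast
  qed
  show ?thesis unfolding smooth_def
  proof (intro allI ballI)
    fix n z assume z: "z \<in> I"
    obtain u where u: "u \<in> diff_alg G" "\<forall>z\<in>I. (deriv ^^ n) f z = u z" using iter by blast
    obtain u' where "\<forall>z\<in>I. (u has_real_derivative u' z) (at z)"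
      using diff_alg_deriv[OF G u(1)] by blast
    then show "(deriv ^^ n) f differentiable at z"
      using step[OF u(2) z] z real_differentiable_def by blast
  qed
qed

section \<open>Metrics that are not conformally extremal\<close>

text \<open>
The value of \<open>c'\<close> for which the scalar curvature is \<open>k\<close>, and the value of \<open>F''''\<close> for which the first
equation of \<open>Bt_flat_CSC_iff\<close> holds.
\<close>

definition c1_rhs :: "real \<Rightarrow> real \<Rightarrow> real \<Rightarrow> real \<Rightarrow> real \<Rightarrow> real \<Rightarrow> real" where
  "c1_rhs k F F1 F2 c C =
     1 / 24 * (8 - 2 * F - 4 * F2 - 24 * F * (c * c) - 24 * c * F1 - k * C) * (1 / F)"

definition F4_rhs :: "real \<Rightarrow> real \<Rightarrow> real \<Rightarrow> real \<Rightarrow> real \<Rightarrow> real \<Rightarrow> real \<Rightarrow> real" where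
  "F4_rhs t k F F1 F2 c C =
     5 * F2 - 4 * F + 4 - 3 / 2 * t * k * C * (c * c - c1_rhs k F F1 F2 c C - 1 / 4)"

lemma lipschitz_on_fst_snd_ex:
  fixes f :: "'a::metric_space \<Rightarrow> 'b::metric_space \<times> 'c::metric_space"
  assumes "\<exists>L. L-lipschitz_on S f"
  shows "\<exists>L. L-lipschitz_on S (\<lambda>x. fst (f x))" "\<exists>L. L-lipschitz_on S (\<lambda>x. snd (f x))"
  using assms unfolding lipschitz_on_def
  by (meson dist_fst_le dist_snd_le order_trans)+

text \<open>
On the ball of radius \<open>1/2\<close> about the initial point \<open>F\<close> and \<open>C\<close> are at least \<open>1/2\<close>. This bounds the only
denominator of the equation and keeps the metric positive definite.
\<close>

lemma CSC_Bt_flat_ODE: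
  fixes t k a :: real
  obtains h F F1 F2 F3 c C where "h > 0"
    "U2_geometry {-h<..<h} F F1 F2 F3 (\<lambda>z. F4_rhs t k (F z) (F1 z) (F2 z) (c z) (C z)) C c
       (\<lambda>z. c1_rhs k (F z) (F1 z) (F2 z) (c z) (C z))"
    "F 0 = 1" "F1 0 = 1" "F2 0 = 0" "F3 0 = a" "c 0 = 0" "C 0 = 1"
proof -
  define V :: "real \<times> real \<times> real \<times> real \<times> real \<times> real \<Rightarrow> real \<times> real \<times> real \<times> real \<times> real \<times> real"
    where "V x = (let F = fst x; F1 = fst (snd x); F2 = fst (snd (snd x)); F3 = fst (snd (snd (snd x)));
        c = fst (snd (snd (snd (snd x)))); C = snd (snd (snd (snd (snd x))))
      in (F1, F2, F3, F4_rhs t k F F1 F2 c C, c1_rhs k F F1 F2 c C, 2 * c * C))" for x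
  define x0 :: "real \<times> real \<times> real \<times> real \<times> real \<times> real" where "x0 = (1, 1, 0, a, 0, 1)"
  define B where "B = cball x0 (1 / 2)"
  have proj: "\<exists>L. L-lipschitz_on B (\<lambda>x. fst x)" "\<exists>L. L-lipschitz_on B (\<lambda>x. fst (snd x))"
    "\<exists>L. L-lipschitz_on B (\<lambda>x. fst (snd (snd x)))" "\<exists>L. L-lipschitz_on B (\<lambda>x. fst (snd (snd (snd x))))"
    "\<exists>L. L-lipschitz_on B (\<lambda>x. fst (snd (snd (snd (snd x)))))"
    "\<exists>L. L-lipschitz_on B (\<lambda>x. snd (snd (snd (snd (snd x)))))"
    by (intro lipschitz_on_fst_snd_ex exI[of _ 1] lipschitz_on_id)+
  have cst: "\<exists>L. L-lipschitz_on B (\<lambda>_. u)" for u :: real using lipschitz_on_constant by blast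
  have near: "fst x \<ge> 1 / 2" "snd (snd (snd (snd (snd x)))) \<ge> 1 / 2" if x: "x \<in> B" for x
  proof -
    have "dist (fst x0) (fst x) \<le> 1 / 2"
      using x dist_fst_le[of x0 x] by (auto simp: B_def)
    then have "\<bar>1 - fst x\<bar> \<le> 1 / 2" by (simp add: x0_def dist_real_def)
    then show "fst x \<ge> 1 / 2" by linarith
    have "dist (snd (snd (snd (snd (snd x0))))) (snd (snd (snd (snd (snd x))))) \<le> dist x0 x"
      by (intro order_trans[OF dist_snd_le] dist_snd_le order_refl)
    then have "\<bar>1 - snd (snd (snd (snd (snd x))))\<bar> \<le> 1 / 2"
      using x by (simp add: x0_def dist_real_def B_def)
    then show "snd (snd (snd (snd (snd x)))) \<ge> 1 / 2" by linarith
  qed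
  note lips = proj cst lipschitz_on_add_diff_ex lipschitz_on_cball_mult_ex[of x0 "1 / 2", folded B_def]
    lipschitz_on_Pair_ex
  have inv: "\<exists>L. L-lipschitz_on B (\<lambda>x. 1 / fst x)"
    using near by (intro lipschitz_on_inverse_of_bounded_below[of _ _ "1 / 2"] lips) auto
  have "\<exists>L. L-lipschitz_on B V"
    unfolding V_def[abs_def] Let_def F4_rhs_def c1_rhs_def by (intro lips inv)
  then obtain L where "L-lipschitz_on (cball x0 (1 / 2)) V" unfolding B_def by blast
  then obtain h x where h: "h > 0" and x0: "x 0 = x0" and xB: "\<And>z. \<bar>z\<bar> < h \<Longrightarrow> x z \<in> B"
    and x': "\<And>z. \<bar>z\<bar> < h \<Longrightarrow> (x has_vector_derivative V (x z)) (at z)"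
    using picard_local_solution[of "1 / 2" L x0 V] unfolding B_def by auto
  define F where "F z = fst (x z)" for z
  define F1 where "F1 z = fst (snd (x z))" for z
  define F2 where "F2 z = fst (snd (snd (x z)))" for z
  define F3 where "F3 z = fst (snd (snd (snd (x z))))" for z
  define c where "c z = fst (snd (snd (snd (snd (x z)))))" for z
  define C where "C z = snd (snd (snd (snd (snd (x z)))))" for z
  note defs = F_def F1_def F2_def F3_def c_def C_def
  have "U2_geometry {-h<..<h} F F1 F2 F3 (\<lambda>z. F4_rhs t k (F z) (F1 z) (F2 z) (c z) (C z)) C c
       (\<lambda>z. c1_rhs k (F z) (F1 z) (F2 z) (c z) (C z))"
  proof unfold_locales
    fix z assume "z \<in> {-h<..<h}"
    then have z: "\<bar>z\<bar> < h" by auto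
    show "F z > 0" "C z > 0" using near[OF xB[OF z]] by (auto simp: F_def C_def)
    note fst' = bounded_linear.has_vector_derivative[OF bounded_linear_fst]
    note snd' = bounded_linear.has_vector_derivative[OF bounded_linear_snd]
    note d1 = snd'[OF x'[OF z]]
    note d2 = snd'[OF d1]
    note d3 = snd'[OF d2]
    note d4 = snd'[OF d3]
    note ds = fst'[OF x'[OF z]] fst'[OF d1] fst'[OF d2] fst'[OF d3] fst'[OF d4] snd'[OF d4]
    show "(F has_real_derivative F1 z) (at z)" "(F1 has_real_derivative F2 z) (at z)"
      "(F2 has_real_derivative F3 z) (at z)"
      "(F3 has_real_derivative F4_rhs t k (F z) (F1 z) (F2 z) (c z) (C z)) (at z)"
      "(C has_real_derivative 2 * c z * C z) (at z)"
      "(c has_real_derivative c1_rhs k (F z) (F1 z) (F2 z) (c z) (C z)) (at z)"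
      using ds unfolding has_real_derivative_iff_has_vector_derivative
      by (simp_all add: V_def Let_def defs[abs_def])
  qed simp
  moreover have "F 0 = 1" "F1 0 = 1" "F2 0 = 0" "F3 0 = a" "c 0 = 0" "C 0 = 1"
    by (simp_all add: defs x0 x0_def)
  ultimately show ?thesis using that h by blast
qed

text \<open>
The second equation of \<open>Bt_flat_CSC_iff\<close> is \<open>E = 0\<close> for the function \<open>E\<close> below, and \<open>E\<close> is constant
along solutions; this is the divergence identity of the Euler-Lagrange tensor. With \<open>k = 36\<close> the
initial values give \<open>c' = - 5/4\<close>, hence \<open>gap41 = 1\<close> at \<open>0\<close>, and the initial value of \<open>F'''\<close> is the
solution of the linear equation \<open>E = 0\<close> there. Since \<open>t \<noteq> 0\<close>, \<open>extremal_op\<close> is nonzero at \<open>0\<close>.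
\<close>

lemma exists_CSC_Bt_flat_not_conformally_extremal:
  fixes t :: real
  assumes t: "t \<noteq> 0"
  shows "\<exists>I F C. U2_data I F C \<and> CSC (cylinder I) (U2_metric F C) \<and>
    Bt_flat t (cylinder I) (U2_metric F C) \<and> \<not> conformally_extremal I (U2_metric F C)"
proof -
  define k :: real where "k = 36"
  obtain h F F1 F2 F3 c C where h: "h > 0" and geo:
    "U2_geometry {-h<..<h} F F1 F2 F3 (\<lambda>z. F4_rhs t k (F z) (F1 z) (F2 z) (c z) (C z)) C c
       (\<lambda>z. c1_rhs k (F z) (F1 z) (F2 z) (c z) (C z))"
    and init: "F 0 = 1" "F1 0 = 1" "F2 0 = 0" "F3 0 = 5 / 2 + 81 * t" "c 0 = 0" "C 0 = 1"
    using CSC_Bt_flat_ODE by blast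
  define I where "I = {-h<..<h}"
  define F4 where "F4 z = F4_rhs t k (F z) (F1 z) (F2 z) (c z) (C z)" for z
  define c1 where "c1 z = c1_rhs k (F z) (F1 z) (F2 z) (c z) (C z)" for z
  interpret U2_geometry I F F1 F2 F3 F4 C c c1
    using geo unfolding I_def F4_def[abs_def] c1_def[abs_def] .
  have zero: "0 \<in> I" using h by (simp add: I_def)
  have I: "convex I" unfolding I_def by simp
  define G where "G = {F, F1, F2, F3, c, C, \<lambda>z. 1 / F z}"
  have gen: "F \<in> diff_alg G" "F1 \<in> diff_alg G" "F2 \<in> diff_alg G" "F3 \<in> diff_alg G" "c \<in> diff_alg G" "C \<in> diff_alg G"
    "(\<lambda>z. 1 / F z) \<in> diff_alg G"
    by (auto simp: G_def intro: diff_alg.gen)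
  have c1_alg: "c1 \<in> diff_alg G" unfolding c1_def[abs_def] c1_rhs_def by (intro gen diff_alg.const diff_alg.add diff_alg.mult diff_alg_diff)
  have F4_alg: "F4 \<in> diff_alg G" unfolding F4_def[abs_def] F4_rhs_def c1_def[symmetric]
    by (intro gen c1_alg diff_alg.const diff_alg.add diff_alg.mult diff_alg_diff)
  have C'_alg: "(\<lambda>z. 2 * c z * C z) \<in> diff_alg G" by (intro gen diff_alg.const diff_alg.mult)
  have inv_alg: "(\<lambda>z. - 1 * F1 z * (1 / F z) * (1 / F z)) \<in> diff_alg G" by (intro gen diff_alg.const diff_alg.mult)
  have inv_deriv: "((\<lambda>z. 1 / F z) has_real_derivative - 1 * F1 z * (1 / F z) * (1 / F z)) (at z)"
    if z: "z \<in> I" for z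
    using F_pos[OF z] by (auto intro!: derivative_eq_intros has_derivs z simp: field_simps)
  have closed: "\<exists>f'\<in>diff_alg G. \<forall>z\<in>I. (f has_real_derivative f' z) (at z)" if "f \<in> G" for f
  proof -
    consider "f = F" | "f = F1" | "f = F2" | "f = F3" | "f = c" | "f = C" | "f = (\<lambda>z. 1 / F z)"
      using \<open>f \<in> G\<close> unfolding G_def by blast
    then show ?thesis
    proof cases
      case 1 then show ?thesis by (intro bexI[OF _ gen(2)]) (simp add: dF)
    next
      case 2 then show ?thesis by (intro bexI[OF _ gen(3)]) (simp add: dF1)
    next
      case 3 then show ?thesis by (intro bexI[OF _ gen(4)]) (simp add: dF2)
    next
      case 4 then show ?thesis by (intro bexI[OF _ F4_alg]) (simp add: dF3)
    next
      case 5 then show ?thesis by (intro bexI[OF _ c1_alg]) (simp add: dc)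
    next
      case 6 then show ?thesis by (intro bexI[OF _ C'_alg]) (simp add: dC)
    next
      case 7 then show ?thesis using inv_deriv by (intro bexI[OF _ inv_alg]) simp
    qed
  qed
  have smooth: "smooth I F" "smooth I C"
    using diff_alg_smooth[OF open_I closed] gen by blast+
  have data: "U2_data I F C"
    unfolding U2_data_def using smooth open_I zero F_pos C_pos
    by (auto simp: I_def is_interval_convex_1)
  have scal_comp: "scal_comp z = k" if z: "z \<in> I" for z
    using F_pos[OF z] C_pos[OF z] by (simp add: scal_comp_def c1_def c1_rhs_def field_simps power2_eq_square)
  have extremal_op: "2 * extremal_op z = - 3 * t * k * C z * gap41 z" for z
    by (simp add: extremal_op_def gap41_def F4_def F4_rhs_def c1_def power2_eq_square algebra_simps)
  \<comment> \<open>By the equation for \<open>c'\<close> the right side of the \<open>energy\<close> equation is free of \<open>c'\<close> and \<open>F''\<close>.\<close>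
  define Z where "Z z = F z - 4 + 4 * c z * F1 z + 12 * F z * (c z)\<^sup>2 + k * C z / 4" for z
  have Z: "gap12 z + 6 * F z * gap41 z = Z z" if z: "z \<in> I" for z
    using F_pos[OF z]
    by (simp add: gap12_def gap41_def Z_def c1_def c1_rhs_def field_simps power2_eq_square)
  define E where "E z = 4 * energy z + 3 * t * k * C z * Z z" for z
  have c1_eq: "24 * F z * c1 z = 8 - 2 * F z - 4 * F2 z - 24 * F z * (c z)\<^sup>2 - 24 * c z * F1 z - k * C z"
    if z: "z \<in> I" for z
    using F_pos[OF z] by (simp add: c1_def c1_rhs_def field_simps power2_eq_square)
  have E_deriv: "(E has_real_derivative 0) (at z)" if z: "z \<in> I" for z
  proof -
    have "(E has_real_derivative 4 * (- 2 * F1 z * extremal_op z) + 3 * t * k * (2 * c z * C z * Z z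
        + C z * (F1 z + 4 * c1 z * F1 z + 4 * c z * F2 z + 12 * F1 z * (c z)\<^sup>2
            + 24 * F z * c z * c1 z + k * (2 * c z * C z) / 4))) (at z)"
      unfolding E_def[abs_def] Z_def[abs_def]
      by (auto intro!: derivative_eq_intros has_derivs energy_deriv[THEN DERIV_cong] z
          simp: algebra_simps power2_eq_square)
    moreover have "4 * (- 2 * F1 z * extremal_op z) + 3 * t * k * (2 * c z * C z * Z z
        + C z * (F1 z + 4 * c1 z * F1 z + 4 * c z * F2 z + 12 * F1 z * (c z)\<^sup>2
            + 24 * F z * c z * c1 z + k * (2 * c z * C z) / 4)) = 0"
      using extremal_op[of z] c1_eq[OF z] unfolding gap41_def Z_def by algebra
    ultimately show ?thesis by simp
  qed
  have E0: "E z = 0" if z: "z \<in> I" for z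
  proof -
    obtain e where e: "\<And>x. x \<in> I \<Longrightarrow> E x = e"
      using DERIV_zero_imp_const_on[OF I E_deriv] by blast
    have "E 0 = 0" by (simp add: E_def energy_def Z_def init k_def)
    then show ?thesis using e[OF z] e[OF zero] by simp
  qed
  have "Bt_flat t (cylinder I) g"
  proof (rule Bt_flat_CSC_iff[of k t, OF scal_comp, THEN iffD2], assumption, intro ballI conjI extremal_op)
    show "4 * energy z = - 3 * t * k * C z * (gap12 z + 6 * F z * gap41 z)" if z: "z \<in> I" for z
      using E0[OF z] unfolding Z[OF z] E_def by linarith
  qed
  moreover have "CSC (cylinder I) g" unfolding CSC_iff using scal_comp by blast
  moreover have "\<not> conformally_extremal I g"
  proof
    assume "conformally_extremal I g"
    then have "extremal_op 0 = 0" using conformally_extremal_imp_extremal_op_zero[OF I _ zero] by blast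
    then show False
      using extremal_op[of 0] t by (simp add: gap41_def c1_def c1_rhs_def init k_def)
  qed
  ultimately show ?thesis using data by blast
qed

section \<open>The three statements\<close>

lemma U2_data_imp_geometry:
  assumes "U2_data I F C"
  shows "U2_geometry I F (deriv F) ((deriv ^^ 2) F) ((deriv ^^ 3) F) ((deriv ^^ 4) F) C
    (\<lambda>z. deriv C z / (2 * C z))
    (\<lambda>z. ((deriv ^^ 2) C z * C z - (deriv C z)\<^sup>2) / (2 * (C z)\<^sup>2))"
proof unfold_locales
  have F: "smooth I F" and C: "smooth I C" and pos: "\<And>z. z \<in> I \<Longrightarrow> F z > 0 \<and> C z > 0"
    using assms by (auto simp: U2_data_def)
  show "open I" using assms by (simp add: U2_data_def)
  fix z assume z: "z \<in> I"
  show "F z > 0" "C z > 0" using pos[OF z] by auto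
  show "(F has_real_derivative deriv F z) (at z)"
    "(deriv F has_real_derivative (deriv ^^ 2) F z) (at z)"
    "((deriv ^^ 2) F has_real_derivative (deriv ^^ 3) F z) (at z)"
    "((deriv ^^ 3) F has_real_derivative (deriv ^^ 4) F z) (at z)"
    using smooth_DERIV[OF F z, of 0] smooth_DERIV[OF F z, of 1] smooth_DERIV[OF F z, of 2]
      smooth_DERIV[OF F z, of 3]
    by (simp_all add: numeral_eq_Suc)
  have dC: "(C has_real_derivative deriv C z) (at z)"
    "(deriv C has_real_derivative (deriv ^^ 2) C z) (at z)"
    using smooth_DERIV[OF C z, of 0] smooth_DERIV[OF C z, of 1] by (simp_all add: numeral_eq_Suc)
  then show "(C has_real_derivative 2 * (deriv C z / (2 * C z)) * C z) (at z)"
    using pos[OF z] by simp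
  show "((\<lambda>z. deriv C z / (2 * C z)) has_real_derivative
      ((deriv ^^ 2) C z * C z - (deriv C z)\<^sup>2) / (2 * (C z)\<^sup>2)) (at z)"
    using pos[OF z] dC[THEN DERIV_cong]
    by (auto intro!: derivative_eq_intros simp: field_simps power2_eq_square)
qed

theorem theorem3p11:
  shows
    "(\<forall>I F C t. U2_data I F C \<longrightarrow>
        (ZSC (cylinder I) (U2_metric F C) \<and> Bt_flat t (cylinder I) (U2_metric F C) \<longleftrightarrow>
         ZSC (cylinder I) (U2_metric F C) \<and> Bach_flat (cylinder I) (U2_metric F C))) \<and>
     (\<forall>I F C t. U2_data I F C \<longrightarrow> t \<noteq> 0 \<longrightarrow> t \<noteq> - 1 / 3 \<longrightarrow>
        Bt_flat t (cylinder I) (U2_metric F C) \<longrightarrow> conformally_extremal I (U2_metric F C) \<longrightarrow>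
        (CSC (cylinder I) (U2_metric F C) \<longleftrightarrow>
         ZSC (cylinder I) (U2_metric F C) \<or> Einstein (cylinder I) (U2_metric F C))) \<and>
     (\<forall>t. t \<noteq> 0 \<longrightarrow>
        (\<exists>I F C. U2_data I F C \<and>
           CSC (cylinder I) (U2_metric F C) \<and> Bt_flat t (cylinder I) (U2_metric F C) \<and>
           \<not> conformally_extremal I (U2_metric F C)))"
proof (intro conjI allI impI)
  fix I F C t assume "U2_data I F C"
  then have "open I" by (simp add: U2_data_def)
  then show "ZSC (cylinder I) (U2_metric F C) \<and> Bt_flat t (cylinder I) (U2_metric F C) \<longleftrightarrow>
      ZSC (cylinder I) (U2_metric F C) \<and> Bach_flat (cylinder I) (U2_metric F C)"
    using ZSC_Bt_flat_iff_Bach_flat by blast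
next
  fix I F C and t :: real
  assume data: "U2_data I F C" and t: "t \<noteq> 0" "t \<noteq> - 1 / 3"
    and Bt: "Bt_flat t (cylinder I) (U2_metric F C)"
    and ext: "conformally_extremal I (U2_metric F C)"
  interpret U2_geometry I F "deriv F" "(deriv ^^ 2) F" "(deriv ^^ 3) F" "(deriv ^^ 4) F" C
    "\<lambda>z. deriv C z / (2 * C z)"
    "\<lambda>z. ((deriv ^^ 2) C z * C z - (deriv C z)\<^sup>2) / (2 * (C z)\<^sup>2)"
    by (rule U2_data_imp_geometry[OF data])
  have I: "convex I" using data by (simp add: U2_data_def is_interval_convex_1)
  show "CSC (cylinder I) (U2_metric F C) \<longleftrightarrow>
      ZSC (cylinder I) (U2_metric F C) \<or> Einstein (cylinder I) (U2_metric F C)"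
    by (rule CSC_iff_ZSC_or_Einstein[OF I conformally_extremal_imp_extremal_op_zero[OF I ext] t Bt])
qed (rule exists_CSC_Bt_flat_not_conformally_extremal)

end
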